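(* Fix constants $C,L>0$. For each $N$ let $g=(g_1,\dots,g_N)$ have independent coordinates, each having a density with respect to Lebesgue measure on $\mathbf R$ that is bounded by $L$ (with $L$ independent of $N$ and $i$). Let $\mathcal A=\mathcal A_N:\mathbf R^N\to\mathbf R^N$ be a coordinate degree $D=D_N$ algorithm (with respect to the law of $g$) with $\mathbf E\|\mathcal A(g)\|^2\le CN$, and let $\tilde{\mathcal A}$ be its randomized rounding. Let $E=E_N$ be a sequence of energy levels, and assume that one of the following holds as $N\to\infty$: (a) $E=\delta N$ for a fixed $\delta\in(0,1)$, and $D\le o(N)$; (b) $\omega(\log^2 N)\le E\le o(N)$, and $D\le o\big(E/\log^2(N/E)\big)$. Then $\mathbf P\big(\tilde{\mathcal A}(g)\in S(E;g)\big)=o(1)$ as $N\to\infty$.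
   Context: $\Sigma_N=\{\pm1\}^N$, and $\|\cdot\|$ is the Euclidean norm on $\mathbf R^N$. For $g\in\mathbf R^N$ and $E\in\mathbf R$, the solution set is $S(E;g)=\{x\in\Sigma_N:|\langle g,x\rangle|\le 2^{-E}\}$. Coordinate degree: let $\mu_N$ be the law of $g$ on $\mathbf R^N$. For $J\subseteq[N]=\{1,\dots,N\}$ let $V_J$ be the subspace of those $f\in L^2(\mu_N)$ such that $f(g)$ depends only on the coordinates $(g_i)_{i\in J}$, and let $V_{\le D}=\mathrm{span}\{V_J: J\subseteq[N],|J|\le D\}$. The coordinate degree of $f\in L^2(\mu_N)$ is $\min\{D:f\in V_{\le D}\}$. A coordinate degree $D$ algorithm is a measurable map $\mathcal A=(\mathcal A_1,\dots,\mathcal A_N):\mathbf R^N\to\mathbf R^N$ with each $\mathcal A_i\in V_{\le D}$. Randomized rounding: let $U_1,\dots,U_N$ be i.i.d. uniform on $[-1,1]$, independent of $g$, and let $\mathrm{sign}(z)=+1$ if $z>0$ and $-1$ if $z\le0$. Then $\tilde{\mathcal A}(g)=\big(\mathrm{sign}(\mathcal A_1(g)-U_1),\dots,\mathrm{sign}(\mathcal A_N(g)-U_N)\big)\in\Sigma_N$. The probability is over both $g$ and $(U_i)$. *)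

theory Defs
  imports
    "HOL-Probability.Probability"
    "HOL-Library.Landau_Symbols"
    "HOL-Library.Function_Algebras"
begin

text \<open>
  Since the dimension \<open>N\<close> varies, a vector of $\mathbf{R}^N$ is a function
  \<open>nat \<Rightarrow> real\<close> on the index set \<open>{1..N}\<close>, \<^const>\<open>undefined\<close> elsewhere, and the
  Borel space $\mathbf{R}^N$ is the product space below. The
  Euclidean norm is \<open>L2_set _ {1..N}\<close>.
\<close>

abbreviation RN :: "nat set \<Rightarrow> (nat \<Rightarrow> real) measure" where
  "RN J \<equiv> PiM J (\<lambda>_. borel)"

definition vec_of :: "nat \<Rightarrow> (nat \<Rightarrow> 'a \<Rightarrow> real) \<Rightarrow> 'a \<Rightarrow> nat \<Rightarrow> real" where
  "vec_of N X = (\<lambda>\<omega>. \<lambda>i\<in>{1..N}. X i \<omega>)"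

definition sign_cube :: "nat \<Rightarrow> (nat \<Rightarrow> real) set" where
  "sign_cube N = {1..N} \<rightarrow>\<^sub>E {-1, 1}"

definition solution_set :: "nat \<Rightarrow> real \<Rightarrow> (nat \<Rightarrow> real) \<Rightarrow> (nat \<Rightarrow> real) set" where
  "solution_set N E g = {x \<in> sign_cube N. \<bar>\<Sum>i=1..N. g i * x i\<bar> \<le> 2 powr (- E)}"

definition bounded_density :: "real \<Rightarrow> 'a measure \<Rightarrow> ('a \<Rightarrow> real) \<Rightarrow> bool" where
  "bounded_density L M X \<longleftrightarrow>
     (\<exists>p :: real \<Rightarrow> real. (\<forall>x. 0 \<le> p x \<and> p x \<le> L) \<and> distributed M lborel X (\<lambda>x. ennreal (p x)))"

text \<open>
  $L^2(\mu)$ is rendered by genuine functions rather than almost-everywhere classes. The space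
  \<open>coord_space \<mu> J\<close> ($V_J$) is closed under almost-everywhere equality among measurable functions,
  and hence so is the span \<open>coord_deg_le N \<mu> D\<close> ($V_{\le D}$), so both are exactly the unions of the
  corresponding classes.
\<close>

definition L2_space :: "'a measure \<Rightarrow> ('a \<Rightarrow> real) set" where
  "L2_space \<mu> = {f \<in> borel_measurable \<mu>. integrable \<mu> (\<lambda>x. (f x)\<^sup>2)}"

definition coord_space :: "(nat \<Rightarrow> real) measure \<Rightarrow> nat set \<Rightarrow> ((nat \<Rightarrow> real) \<Rightarrow> real) set" where
  "coord_space \<mu> J =
     {f \<in> L2_space \<mu>. \<exists>h \<in> borel_measurable (RN J). AE x in \<mu>. f x = h (restrict x J)}"

definition coord_deg_le ::
    "nat \<Rightarrow> (nat \<Rightarrow> real) measure \<Rightarrow> nat \<Rightarrow> ((nat \<Rightarrow> real) \<Rightarrow> real) set" where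
  "coord_deg_le N \<mu> D =
     module.span (\<lambda>(c :: real) f. \<lambda>x. c * f x) (\<Union>J\<in>{J. J \<subseteq> {1..N} \<and> card J \<le> D}. coord_space \<mu> J)"

definition coord_deg_algorithm ::
    "nat \<Rightarrow> (nat \<Rightarrow> real) measure \<Rightarrow> nat \<Rightarrow> ((nat \<Rightarrow> real) \<Rightarrow> nat \<Rightarrow> real) \<Rightarrow> bool" where
  "coord_deg_algorithm N \<mu> D A \<longleftrightarrow>
     A \<in> RN {1..N} \<rightarrow>\<^sub>M RN {1..N} \<and> (\<forall>i\<in>{1..N}. (\<lambda>x. A x i) \<in> coord_deg_le N \<mu> D)"

text \<open>Unlike \<^const>\<open>sgn\<close>, the sign of zero is \<open>-1\<close>.\<close>

definition sign_pm :: "real \<Rightarrow> real" where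
  "sign_pm z = (if z > 0 then 1 else -1)"

definition rounding ::
    "nat \<Rightarrow> ((nat \<Rightarrow> real) \<Rightarrow> nat \<Rightarrow> real) \<Rightarrow> (nat \<Rightarrow> real) \<Rightarrow> (nat \<Rightarrow> real) \<Rightarrow> nat \<Rightarrow> real" where
  "rounding N A g u = (\<lambda>i\<in>{1..N}. sign_pm (A g i - u i))"

text \<open>The span above is the library's span in the vector space of real functions.\<close>

lemma real_fun_vector_space: "vector_space (\<lambda>(c :: real) (f :: 'a \<Rightarrow> real). \<lambda>x. c * f x)"
  by unfold_locales (auto simp: fun_eq_iff algebra_simps)

end

theory Submission
  imports Defs "HOL-Real_Asymp.Real_Asymp"
begin

text \<open>
  Call \<open>flips g\<close> the expected number of coordinates in which the rounding of \<open>A g\<close> differs from its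
  most likely value, and let \<open>K\<close> tend to infinity with \<open>D = o(K)\<close> and such that the number of sign vectors
  within Hamming distance \<open>K\<close> of a given one is \<open>o(2 powr E)\<close>.

  If \<open>flips g\<close> is bounded, resample a single coordinate \<open>i\<close> of \<open>g\<close>. By Jensen, the probability that
  the old and the new rounding (with the same randomness \<open>u\<close>) both solve their instance is at least
  the square of the probability of solving. A function of coordinate degree \<open>D\<close> has total influence
  at most \<open>D\<close> times its second moment, so for some \<open>i\<close> the output moves by only \<open>O(D)\<close> in squared
  norm and the two roundings are within distance \<open>K\<close> with high probability. But the new instance has
  a fresh coordinate with bounded density, so each fixed vector solves it with probability
  \<open>O(2 powr - E)\<close>, and a union bound over the ball of radius \<open>K\<close> finishes.

  If \<open>flips g\<close> is large, fix \<open>g\<close> and resample \<open>u\<close> on a block of coordinates that contributes about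
  \<open>R\<close> expected flips. The new rounding is within distance \<open>K\<close> of the old one, and different from it
  except with probability \<open>exp (- R)\<close>. Two distinct solutions at distance at most \<open>K\<close> would give a
  signed subsum of at most \<open>K\<close> entries of \<open>g\<close> of size \<open>2 powr - E\<close>, which is again excluded by a union
  bound.
\<close>

section \<open>Resampling coordinates of a product measure\<close>

context product_prob_space
begin

text \<open>By Fubini with coordinate \<open>i\<close> split off: after the update the integrand
  ignores the old value of \<open>x i\<close>, whose law has mass one.\<close>

lemma nn_integral_resample_coordinate:
  assumes "finite I" "i \<in> I" and f: "f \<in> borel_measurable (PiM I M)"
  shows "(\<integral>\<^sup>+x. (\<integral>\<^sup>+y. f (x(i := y)) \<partial>M i) \<partial>PiM I M) = (\<integral>\<^sup>+x. f x \<partial>PiM I M)"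
proof -
  define I' where "I' = I - {i}"
  have I': "I = insert i I'" "finite I'" "i \<notin> I'"
    using assms by (auto simp: I'_def)
  note f[unfolded I'(1), measurable]
  have upd[measurable]: "(\<lambda>(x, y). x(i := y)) \<in> PiM (insert i I') M \<Otimes>\<^sub>M M i \<rightarrow>\<^sub>M PiM (insert i I') M"
    using measurable_add_dim[of i "insert i I'" M] by (simp add: insert_absorb)
  have m: "(\<lambda>(x, y). f (x(i := y))) \<in> borel_measurable (PiM (insert i I') M \<Otimes>\<^sub>M M i)"
    using measurable_compose[OF upd, of f borel] by (simp add: split_beta')
  show ?thesis
    unfolding I'(1)
    apply (subst (1 2) product_nn_integral_insert)
    using I' m by (auto simp: M.emeasure_space_1 intro!: borel_measurable_nn_integral)
qed

lemma measurable_override_on[measurable]: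
  assumes "B \<subseteq> I"
  shows "(\<lambda>(x, x'). override_on x x' B) \<in> PiM I M \<Otimes>\<^sub>M PiM I M \<rightarrow>\<^sub>M PiM I M"
proof (rule measurable_PiM_single')
  fix i assume "i \<in> I"
  then show "(\<lambda>p. (case p of (x, x') \<Rightarrow> override_on x x' B) i) \<in> PiM I M \<Otimes>\<^sub>M PiM I M \<rightarrow>\<^sub>M M i"
    by (cases "i \<in> B") (simp_all add: split_beta')
next
  show "(\<lambda>p i. (case p of (x, x') \<Rightarrow> override_on x x' B) i)
      \<in> space (PiM I M \<Otimes>\<^sub>M PiM I M) \<rightarrow> (\<Pi>\<^sub>E i\<in>I. space (M i))"
    using assms by (auto simp: space_pair_measure space_PiM override_on_def PiE_iff extensional_def)
qed

text \<open>Conditionally on the coordinates outside \<open>B\<close> the two factors are independent and identically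
  distributed, so this is Jensen's inequality for the square.\<close>

lemma nn_integral_square_le_resample:
  assumes "finite I" "B \<subseteq> I" and f: "f \<in> borel_measurable (PiM I M)"
  shows "(\<integral>\<^sup>+x. f x \<partial>PiM I M)\<^sup>2
    \<le> (\<integral>\<^sup>+x. (\<integral>\<^sup>+x'. f x * f (override_on x x' B) \<partial>PiM I M) \<partial>PiM I M)"
proof -
  define B' where "B' = I - B"
  have I: "I = B' \<union> B" "B' \<inter> B = {}" "finite B" "finite B'"
    using assms finite_subset by (auto simp: B'_def)
  interpret PB: product_prob_space M B ..
  interpret PB': product_prob_space M B' ..
  note f[unfolded I(1), measurable]
  have fm: "(\<lambda>(z, w). f (merge B' B (z, w))) \<in> borel_measurable (PiM B' M \<Otimes>\<^sub>M PiM B M)"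
    using measurable_compose[OF measurable_merge[of B' B M], of f borel] I
    by (simp add: split_beta')
  \<comment> \<open>The conditional expectation of \<open>f\<close> given the coordinates outside
    \<open>B\<close>. The right-hand side of the claim is the integral of its square, and
    Cauchy-Schwarz against the constant one finishes.\<close>
  define \<phi> where "\<phi> z = (\<integral>\<^sup>+w. f (merge B' B (z, w)) \<partial>PiM B M)" for z
  have \<phi>[measurable]: "\<phi> \<in> borel_measurable (PiM B' M)"
    unfolding \<phi>_def using fm by measurable
  have fold: "(\<integral>\<^sup>+x. h x \<partial>PiM I M) = (\<integral>\<^sup>+z. (\<integral>\<^sup>+w. h (merge B' B (z, w)) \<partial>PiM B M) \<partial>PiM B' M)"
    if "h \<in> borel_measurable (PiM (B' \<union> B) M)" for h :: "_ \<Rightarrow> ennreal"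
    unfolding I(1) using that I by (intro product_nn_integral_fold) auto
  have inner: "(\<integral>\<^sup>+x'. f (override_on x x' B) \<partial>PiM I M) = \<phi> (restrict x B')"
    if "x \<in> space (PiM I M)" for x
  proof -
    have "(\<lambda>x'. override_on x x' B) \<in> PiM I M \<rightarrow>\<^sub>M PiM I M"
      using measurable_compose_Pair1[OF that measurable_override_on[OF assms(2)]] by simp
    then have "(\<integral>\<^sup>+x'. f (override_on x x' B) \<partial>PiM I M)
        = (\<integral>\<^sup>+z. (\<integral>\<^sup>+w. f (override_on x (merge B' B (z, w)) B) \<partial>PiM B M) \<partial>PiM B' M)"
      by (intro fold) (use f I(1) in simp)
    also have "\<dots> = (\<integral>\<^sup>+z. (\<integral>\<^sup>+w. f (merge B' B (restrict x B', w)) \<partial>PiM B M) \<partial>PiM B' M)"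
      using I(2) that I(1)
      by (intro nn_integral_cong arg_cong[of _ _ f])
         (auto simp: override_on_def merge_def fun_eq_iff space_PiM PiE_iff extensional_def)
    finally show ?thesis
      by (simp add: \<phi>_def PB'.emeasure_space_1)
  qed
  have "(\<integral>\<^sup>+x. f x \<partial>PiM I M)\<^sup>2 = (\<integral>\<^sup>+z. \<phi> z * 1 \<partial>PiM B' M)\<^sup>2"
    unfolding \<phi>_def by (simp add: fold)
  also have "\<dots> \<le> (\<integral>\<^sup>+z. (\<phi> z)\<^sup>2 \<partial>PiM B' M) * (\<integral>\<^sup>+z. 1\<^sup>2 \<partial>PiM B' M)"
    by (rule Cauchy_Schwarz_nn_integral) auto
  also have "\<dots> = (\<integral>\<^sup>+z. \<phi> z * \<phi> z \<partial>PiM B' M)"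
    by (simp add: PB'.emeasure_space_1 power2_eq_square)
  also have "\<dots> = (\<integral>\<^sup>+z. (\<integral>\<^sup>+w. f (merge B' B (z, w)) * \<phi> z \<partial>PiM B M) \<partial>PiM B' M)"
  proof (rule nn_integral_cong)
    fix z assume z: "z \<in> space (PiM B' M)"
    have "(\<lambda>w. f (merge B' B (z, w))) \<in> borel_measurable (PiM B M)"
      using measurable_compose_Pair1[OF z fm] by simp
    then show "\<phi> z * \<phi> z = (\<integral>\<^sup>+w. f (merge B' B (z, w)) * \<phi> z \<partial>PiM B M)"
      by (simp add: nn_integral_multc \<phi>_def)
  qed
  also have "\<dots> = (\<integral>\<^sup>+z. (\<integral>\<^sup>+w. f (merge B' B (z, w)) * \<phi> (restrict (merge B' B (z, w)) B')
      \<partial>PiM B M) \<partial>PiM B' M)"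
    using I(2) by (intro nn_integral_cong) (simp add: restrict_merge space_PiM PiE_iff extensional_restrict)
  also have "\<dots> = (\<integral>\<^sup>+x. f x * \<phi> (restrict x B') \<partial>PiM I M)"
  proof (rule fold[symmetric])
    have "(\<lambda>x. restrict x B') \<in> PiM (B' \<union> B) M \<rightarrow>\<^sub>M PiM B' M"
      by (rule measurable_restrict_subset) auto
    from measurable_compose[OF this \<phi>]
    show "(\<lambda>x. f x * \<phi> (restrict x B')) \<in> borel_measurable (PiM (B' \<union> B) M)"
      by measurable
  qed
  also have "\<dots> = (\<integral>\<^sup>+x. f x * (\<integral>\<^sup>+x'. f (override_on x x' B) \<partial>PiM I M) \<partial>PiM I M)"
    by (intro nn_integral_cong) (simp add: inner)
  also have "\<dots> = (\<integral>\<^sup>+x. (\<integral>\<^sup>+x'. f x * f (override_on x x' B) \<partial>PiM I M) \<partial>PiM I M)"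
  proof (intro nn_integral_cong nn_integral_cmult[symmetric])
    fix x assume "x \<in> space (PiM I M)"
    then have "(\<lambda>x'. override_on x x' B) \<in> PiM I M \<rightarrow>\<^sub>M PiM I M"
      using measurable_compose_Pair1[OF _ measurable_override_on[OF assms(2)]] by simp
    then show "(\<lambda>x'. f (override_on x x' B)) \<in> borel_measurable (PiM I M)"
      using f by (rule measurable_compose)
  qed
  finally show ?thesis .
qed

text \<open>Such exchanges commute with each other, so once they are known to preserve the joint
  law, resampling one coordinate becomes the action of one of a family of commuting
  measure-preserving maps on pairs of independent copies. It suffices to compare rectangles
  \<open>S \<times> T\<close>.\<close>

lemma distr_swap_coordinate:
  assumes "finite I" "i \<in> I"
  shows "distr (PiM I M \<Otimes>\<^sub>M PiM I M) (PiM I M \<Otimes>\<^sub>M PiM I M)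
      (\<lambda>(x, x'). (x(i := x' i), x'(i := x i))) = PiM I M \<Otimes>\<^sub>M PiM I M"
proof (rule pair_measure_eqI[symmetric])
  show "sigma_finite_measure (PiM I M)" ..
  show "sigma_finite_measure (PiM I M)" ..
  show "sets (PiM I M \<Otimes>\<^sub>M PiM I M) = sets (distr (PiM I M \<Otimes>\<^sub>M PiM I M) (PiM I M \<Otimes>\<^sub>M PiM I M)
      (\<lambda>(x, x'). (x(i := x' i), x'(i := x i))))" by simp
  fix S T assume S[measurable]: "S \<in> sets (PiM I M)" and T[measurable]: "T \<in> sets (PiM I M)"
  have upd[measurable]: "(\<lambda>(x, y). x(i := y)) \<in> PiM I M \<Otimes>\<^sub>M M i \<rightarrow>\<^sub>M PiM I M"
    using measurable_add_dim[of i I M] assms by (simp add: insert_absorb)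
  have comp[measurable]: "(\<lambda>x. x i) \<in> PiM I M \<rightarrow>\<^sub>M M i"
    using assms by measurable
  have upd'[measurable]: "(\<lambda>p. (f p)(i := h p)) \<in> L \<rightarrow>\<^sub>M PiM I M"
    if [measurable]: "f \<in> L \<rightarrow>\<^sub>M PiM I M" "h \<in> L \<rightarrow>\<^sub>M M i" for f h and L :: "'l measure"
    using measurable_compose[OF measurable_Pair[OF that] upd] by simp
  \<comment> \<open>\<open>s x\<close> is the conditional probability of \<open>S\<close> given the
    coordinates other than \<open>i\<close>, and \<open>t y\<close> that of \<open>T\<close> given
    the value \<open>y\<close> at \<open>i\<close>. As \<open>s\<close> ignores \<open>x i\<close>,
    the integral of \<open>s x * t (x i)\<close> factorizes.\<close>
  define s t where "s x = (\<integral>\<^sup>+y. indicator S (x(i := y)) \<partial>M i)"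
    and "t y = (\<integral>\<^sup>+x'. indicator T (x'(i := y)) \<partial>PiM I M)" for x :: "'i \<Rightarrow> 'a" and y :: 'a
  have [measurable]: "s \<in> borel_measurable (PiM I M)" "t \<in> borel_measurable (M i)"
    unfolding s_def t_def by measurable
  interpret MI: pair_sigma_finite "M i" "PiM I M" ..
  have "emeasure (distr (PiM I M \<Otimes>\<^sub>M PiM I M) (PiM I M \<Otimes>\<^sub>M PiM I M)
        (\<lambda>(x, x'). (x(i := x' i), x'(i := x i)))) (S \<times> T)
      = (\<integral>\<^sup>+p. indicator (S \<times> T) p \<partial>distr (PiM I M \<Otimes>\<^sub>M PiM I M)
          (PiM I M \<Otimes>\<^sub>M PiM I M) (\<lambda>p. ((fst p)(i := snd p i), (snd p)(i := fst p i))))"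
    by (subst nn_integral_indicator) (auto simp: split_beta')
  also have "\<dots> = (\<integral>\<^sup>+p. indicator (S \<times> T) ((fst p)(i := snd p i), (snd p)(i := fst p i))
          \<partial>(PiM I M \<Otimes>\<^sub>M PiM I M))"
    by (rule nn_integral_distr) measurable
  also have "\<dots> = (\<integral>\<^sup>+p. indicator S ((fst p)(i := snd p i)) * indicator T ((snd p)(i := fst p i))
          \<partial>(PiM I M \<Otimes>\<^sub>M PiM I M))"
    by (simp add: indicator_times)
  also have "\<dots> = (\<integral>\<^sup>+x. (\<integral>\<^sup>+x'. indicator S (x(i := x' i)) * indicator T (x'(i := x i))
          \<partial>PiM I M) \<partial>PiM I M)"
    by (subst P.nn_integral_fst[symmetric]) auto
  also have "\<dots> = (\<integral>\<^sup>+x. s x * t (x i) \<partial>PiM I M)"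
  proof (rule nn_integral_cong)
    fix x assume x[measurable]: "x \<in> space (PiM I M)"
    have [measurable]: "x i \<in> space (M i)"
      using x assms by (auto simp: space_PiM)
    have "(\<integral>\<^sup>+x'. indicator S (x(i := x' i)) * indicator T (x'(i := x i)) \<partial>PiM I M)
        = (\<integral>\<^sup>+x'. (\<integral>\<^sup>+y. indicator S (x(i := y)) * indicator T (x'(i := x i)) \<partial>M i) \<partial>PiM I M)"
      by (subst nn_integral_resample_coordinate[OF assms, symmetric]) auto
    also have "\<dots> = s x * t (x i)"
      unfolding s_def t_def by (simp add: nn_integral_multc nn_integral_cmult)
    finally show "(\<integral>\<^sup>+x'. indicator S (x(i := x' i)) * indicator T (x'(i := x i)) \<partial>PiM I M)
        = s x * t (x i)" .
  qed
  also have "\<dots> = (\<integral>\<^sup>+x. (\<integral>\<^sup>+y. s x * t y \<partial>M i) \<partial>PiM I M)"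
    by (subst nn_integral_resample_coordinate[OF assms, symmetric]) (auto simp: s_def)
  also have "\<dots> = (\<integral>\<^sup>+x. s x \<partial>PiM I M) * (\<integral>\<^sup>+y. t y \<partial>M i)"
    by (simp add: nn_integral_multc nn_integral_cmult)
  also have "(\<integral>\<^sup>+x. s x \<partial>PiM I M) = emeasure (PiM I M) S"
    unfolding s_def by (subst nn_integral_resample_coordinate[OF assms]) auto
  also have "(\<integral>\<^sup>+y. t y \<partial>M i) = (\<integral>\<^sup>+x. (\<integral>\<^sup>+y. indicator T (x(i := y)) \<partial>M i) \<partial>PiM I M)"
    unfolding t_def by (rule MI.Fubini'[symmetric]) measurable
  also have "\<dots> = emeasure (PiM I M) T"
    by (subst nn_integral_resample_coordinate[OF assms]) auto
  finally show "emeasure (PiM I M) S * emeasure (PiM I M) T = emeasure (distr (PiM I M \<Otimes>\<^sub>M PiM I M)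
      (PiM I M \<Otimes>\<^sub>M PiM I M) (\<lambda>(x, x'). (x(i := x' i), x'(i := x i)))) (S \<times> T)" ..
qed

end

section \<open>Influences of functions of low coordinate degree\<close>

text \<open>By invariance of \<open>P\<close> under \<open>r\<close>, \<open>f\<close> and its
  composition with \<open>r\<close> have the same second moment; then the pointwise parallelogram
  identity is integrated. Values in \<open>ennreal\<close> keep this valid for infinite second
  moments.\<close>

lemma nn_integral_square_parallelogram:
  fixes f :: "'a \<Rightarrow> real"
  assumes r: "r \<in> P \<rightarrow>\<^sub>M P" "distr P P r = P" and [measurable]: "f \<in> borel_measurable P"
  shows "(\<integral>\<^sup>+x. ennreal (((f x + f (r x)) / 2)\<^sup>2) \<partial>P) + (\<integral>\<^sup>+x. ennreal (((f x - f (r x)) / 2)\<^sup>2) \<partial>P)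
    = (\<integral>\<^sup>+x. ennreal ((f x)\<^sup>2) \<partial>P)"
proof -
  note r(1)[measurable]
  let ?e = "\<integral>\<^sup>+x. ennreal ((f x)\<^sup>2 / 2) \<partial>P"
  have "?e = (\<integral>\<^sup>+x. ennreal ((f x)\<^sup>2 / 2) \<partial>distr P P r)"
    by (simp add: r(2))
  also have "\<dots> = (\<integral>\<^sup>+x. ennreal ((f (r x))\<^sup>2 / 2) \<partial>P)"
    by (subst nn_integral_distr) auto
  finally have inv: "(\<integral>\<^sup>+x. ennreal ((f (r x))\<^sup>2 / 2) \<partial>P) = ?e" ..
  have parallelogram: "((a + b) / 2)\<^sup>2 + ((a - b) / 2)\<^sup>2 = a\<^sup>2 / 2 + b\<^sup>2 / 2" for a b :: real
    by (simp add: power2_eq_square field_simps)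
  have "(\<integral>\<^sup>+x. ennreal (((f x + f (r x)) / 2)\<^sup>2) \<partial>P) + (\<integral>\<^sup>+x. ennreal (((f x - f (r x)) / 2)\<^sup>2) \<partial>P)
      = (\<integral>\<^sup>+x. ennreal (((f x + f (r x)) / 2)\<^sup>2) + ennreal (((f x - f (r x)) / 2)\<^sup>2) \<partial>P)"
    by (subst nn_integral_add) auto
  also have "\<dots> = (\<integral>\<^sup>+x. ennreal ((f x)\<^sup>2 / 2) + ennreal ((f (r x))\<^sup>2 / 2) \<partial>P)"
    by (intro nn_integral_cong) (simp add: parallelogram flip: ennreal_plus)
  also have "\<dots> = ?e + ?e"
    by (subst nn_integral_add) (auto simp: inv)
  also have "\<dots> = (\<integral>\<^sup>+x. ennreal ((f x)\<^sup>2 / 2) + ennreal ((f x)\<^sup>2 / 2) \<partial>P)"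
    by (subst nn_integral_add) auto
  also have "\<dots> = (\<integral>\<^sup>+x. ennreal ((f x)\<^sup>2) \<partial>P)"
    by (intro nn_integral_cong) (simp add: ennreal_plus[symmetric] del: ennreal_plus)
  finally show ?thesis .
qed

text \<open>Each step of the induction splits \<open>f\<close> into its orthogonal parts that are even and odd under
  one of the maps. The odd part only sees the summands that depend on that index, so its degree in
  the remaining indices drops by one; this pays for the one additional term.\<close>

lemma sum_nn_integral_difference_le:
  fixes f :: "'k \<Rightarrow> 'a \<Rightarrow> real" and r :: "'i \<Rightarrow> 'a \<Rightarrow> 'a"
  assumes "finite I" "finite T"
    and "\<And>i. i \<in> I \<Longrightarrow> r i \<in> P \<rightarrow>\<^sub>M P"
    and "\<And>i. i \<in> I \<Longrightarrow> distr P P (r i) = P"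
    and "\<And>i j x. i \<in> I \<Longrightarrow> j \<in> I \<Longrightarrow> x \<in> space P \<Longrightarrow> r i (r j x) = r j (r i x)"
    and "\<And>k. k \<in> T \<Longrightarrow> f k \<in> borel_measurable P"
    and "\<And>k. k \<in> T \<Longrightarrow> card (J k \<inter> I) \<le> D"
    and "\<And>k i x. k \<in> T \<Longrightarrow> i \<in> I - J k \<Longrightarrow> x \<in> space P \<Longrightarrow> f k (r i x) = f k x"
  shows "(\<Sum>i\<in>I. \<integral>\<^sup>+x. ennreal ((((\<Sum>k\<in>T. f k x) - (\<Sum>k\<in>T. f k (r i x))) / 2)\<^sup>2) \<partial>P)
    \<le> of_nat D * (\<integral>\<^sup>+x. ennreal ((\<Sum>k\<in>T. f k x)\<^sup>2) \<partial>P)"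
  using assms
proof (induction I arbitrary: T f D rule: finite_induct)
  case (insert j I)
  note [measurable] = insert.prems(2)[OF insertI1] insert.prems(5)
  have rm[measurable]: "r i \<in> P \<rightarrow>\<^sub>M P" if "i \<in> I" for i
    using insert.prems(2) that by blast
  have rsp: "r i x \<in> space P" if "i \<in> insert j I" "x \<in> space P" for i x
    using insert.prems(2)[OF that(1)] that(2) by (rule measurable_space)
  define S where "S = {k \<in> T. j \<in> J k}"
  have S: "finite S" "S \<subseteq> T" using insert.prems(1) by (auto simp: S_def)
  have fin: "finite (J k \<inter> insert j I)" for k
    using insert.hyps by blast
  let ?f = "\<lambda>x. \<Sum>k\<in>T. f k x"
  let ?e = "\<lambda>h. \<integral>\<^sup>+x. ennreal ((h x :: real)\<^sup>2) \<partial>P"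
  define p q where "p k x = (f k x + f k (r j x)) / 2" and "q k x = (f k x - f k (r j x)) / 2" for k x
  let ?p = "\<lambda>x. \<Sum>k\<in>T. p k x" and ?q = "\<lambda>x. \<Sum>k\<in>S. q k x"
  \<comment> \<open>Summands outside \<open>S\<close> are invariant under \<open>r j\<close> and
    cancel in the odd part, so the sum over \<open>S\<close> is already all of it.\<close>
  have qs: "?q x = (?f x - ?f (r j x)) / 2" if "x \<in> space P" for x
  proof -
    have "?q x = (\<Sum>k\<in>T. q k x)"
      using insert.prems(1,7) that by (intro sum.mono_neutral_left) (auto simp: S_def q_def)
    then show ?thesis
      by (simp add: q_def sum_subtractf flip: sum_divide_distrib)
  qed
  have ps: "?p x = (?f x + ?f (r j x)) / 2" for x
    by (simp add: p_def sum.distrib flip: sum_divide_distrib)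
  have m[measurable]: "?f \<in> borel_measurable P" "\<And>k. k \<in> T \<Longrightarrow> p k \<in> borel_measurable P"
      "\<And>k. k \<in> S \<Longrightarrow> q k \<in> borel_measurable P"
    using S unfolding p_def q_def by (auto simp: subset_iff)
  have split: "?e h = ?e (\<lambda>x. (h x + h (r j x)) / 2) + ?e (\<lambda>x. (h x - h (r j x)) / 2)"
    if "h \<in> borel_measurable P" for h
    using nn_integral_square_parallelogram[of "r j" P h] insert.prems(2,3) that by simp
  have ee: "?e ?f = ?e ?p + ?e ?q"
    by (subst split) (auto simp: ps qs cong: nn_integral_cong)
  \<comment> \<open>Since \<open>r i\<close> commutes with \<open>r j\<close>, the even and odd
    parts of the difference under \<open>r i\<close> are the differences of the even and odd
    parts.\<close>
  have term_eq: "?e (\<lambda>x. (?f x - ?f (r i x)) / 2)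
      = ?e (\<lambda>x. (?p x - ?p (r i x)) / 2) + ?e (\<lambda>x. (?q x - ?q (r i x)) / 2)" if i: "i \<in> I" for i
  proof (subst split)
    show "(\<lambda>x. (?f x - ?f (r i x)) / 2) \<in> borel_measurable P"
      using i m(1) measurable_compose[OF rm[OF i] m(1)] by simp
    have c: "r i (r j x) = r j (r i x)" if "x \<in> space P" for x
      using insert.prems(4) i that by blast
    have "?e (\<lambda>x. ((?f x - ?f (r i x)) / 2 + (?f (r j x) - ?f (r i (r j x))) / 2) / 2)
        = ?e (\<lambda>x. (?p x - ?p (r i x)) / 2)"
      by (intro nn_integral_cong arg_cong[of _ _ ennreal] arg_cong[of _ _ "\<lambda>x. x\<^sup>2"])
         (simp add: ps c field_simps)
    moreover have "?e (\<lambda>x. ((?f x - ?f (r i x)) / 2 - (?f (r j x) - ?f (r i (r j x))) / 2) / 2)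
        = ?e (\<lambda>x. (?q x - ?q (r i x)) / 2)"
      using i by (intro nn_integral_cong arg_cong[of _ _ ennreal] arg_cong[of _ _ "\<lambda>x. x\<^sup>2"])
         (simp add: qs rsp c field_simps)
    ultimately show "?e (\<lambda>x. ((?f x - ?f (r i x)) / 2 + (?f (r j x) - ?f (r i (r j x))) / 2) / 2)
        + ?e (\<lambda>x. ((?f x - ?f (r i x)) / 2 - (?f (r j x) - ?f (r i (r j x))) / 2) / 2)
        = ?e (\<lambda>x. (?p x - ?p (r i x)) / 2) + ?e (\<lambda>x. (?q x - ?q (r i x)) / 2)"
      by simp
  qed
  have inv: "f k (r j (r i x)) = f k (r j x)" if "k \<in> T" "i \<in> I - J k" "x \<in> space P" for k i x
    using insert.prems(4)[of i j x] insert.prems(7)[of k i "r j x"] rsp[of j x] that by simp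
  have IHp: "(\<Sum>i\<in>I. ?e (\<lambda>x. (?p x - ?p (r i x)) / 2)) \<le> of_nat D * ?e ?p"
  proof (rule insert.IH[OF insert.prems(1)])
    fix k assume k: "k \<in> T"
    have "card (J k \<inter> I) \<le> card (J k \<inter> insert j I)"
      using fin by (intro card_mono) auto
    then show "card (J k \<inter> I) \<le> D"
      using insert.prems(6)[OF k] by linarith
  qed (use insert.prems inv in \<open>auto simp: p_def\<close>)
  \<comment> \<open>For \<open>k\<close> in \<open>S\<close> the set \<open>J k\<close> contains
    \<open>j\<close>, so it meets \<open>I\<close> in at most \<open>D - 1\<close> points. The
    induction hypothesis with \<open>D - 1\<close> leaves room for one copy of \<open>?e ?q\<close>,
    which is exactly the term of the index \<open>j\<close>. If \<open>S\<close> is empty,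
    \<open>?q\<close> vanishes.\<close>
  have IHq: "(\<Sum>i\<in>I. ?e (\<lambda>x. (?q x - ?q (r i x)) / 2)) + ?e ?q \<le> of_nat D * ?e ?q"
  proof (cases "S = {}")
    case False
    have card_less: "card (J k \<inter> I) < D" if k: "k \<in> S" for k
    proof -
      have "J k \<inter> insert j I = insert j (J k \<inter> I)"
        using k by (auto simp: S_def)
      then have "card (J k \<inter> insert j I) = Suc (card (J k \<inter> I))"
        using insert.hyps by simp
      then show ?thesis
        using insert.prems(6)[of k] k S by auto
    qed
    then obtain D' where D': "D = Suc D'"
      using False by (cases D) auto
    have "(\<Sum>i\<in>I. ?e (\<lambda>x. (?q x - ?q (r i x)) / 2)) \<le> of_nat D' * ?e ?q"
      by (rule insert.IH[OF S(1)])
         (use insert.prems inv S card_less D' in \<open>auto simp: q_def less_Suc_eq_le\<close>)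
    then have "(\<Sum>i\<in>I. ?e (\<lambda>x. (?q x - ?q (r i x)) / 2)) + ?e ?q \<le> of_nat D' * ?e ?q + ?e ?q"
      by (rule add_right_mono)
    then show ?thesis
      by (simp add: D' distrib_right add.commute)
  qed simp
  have "(\<Sum>i\<in>insert j I. ?e (\<lambda>x. (?f x - ?f (r i x)) / 2))
      = ?e ?q + (\<Sum>i\<in>I. ?e (\<lambda>x. (?f x - ?f (r i x)) / 2))"
    using insert.hyps by (simp add: qs cong: nn_integral_cong)
  also have "\<dots> = (\<Sum>i\<in>I. ?e (\<lambda>x. (?p x - ?p (r i x)) / 2))
      + ((\<Sum>i\<in>I. ?e (\<lambda>x. (?q x - ?q (r i x)) / 2)) + ?e ?q)"
    by (simp add: term_eq sum.distrib ac_simps)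
  also have "\<dots> \<le> of_nat D * ?e ?p + of_nat D * ?e ?q"
    by (intro add_mono IHp IHq)
  also have "\<dots> = of_nat D * ?e ?f"
    by (simp add: ee distrib_left)
  finally show ?case .
qed simp

section \<open>Coordinate degree via finite sums of functions of few coordinates\<close>

lemma L2_space_sum:
  assumes "finite T" "\<And>a. a \<in> T \<Longrightarrow> f a \<in> L2_space \<mu>"
  shows "(\<lambda>x. \<Sum>a\<in>T. c a * f a x) \<in> L2_space \<mu>"
  using assms
proof (induction T rule: finite_induct)
  case empty
  then show ?case by (simp add: L2_space_def)
next
  case (insert a T)
  define F where "F = (\<lambda>x. \<Sum>a\<in>T. c a * f a x)"
  have F: "F \<in> borel_measurable \<mu>" "integrable \<mu> (\<lambda>x. (F x)\<^sup>2)"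
    using insert.IH[OF insert.prems] by (auto simp: F_def L2_space_def)
  have a: "f a \<in> borel_measurable \<mu>" "integrable \<mu> (\<lambda>x. (f a x)\<^sup>2)"
    using insert.prems unfolding L2_space_def by auto
  have "integrable \<mu> (\<lambda>x. (c a * f a x + F x)\<^sup>2)"
  proof (rule Bochner_Integration.integrable_bound)
    show "integrable \<mu> (\<lambda>x. 2 * (c a)\<^sup>2 * (f a x)\<^sup>2 + 2 * (F x)\<^sup>2)"
      using F a by simp
    have "(u + v)\<^sup>2 \<le> 2 * u\<^sup>2 + 2 * v\<^sup>2" for u v :: real
      using sum_squares_ge_zero[of "u - v" 0] by (simp add: power2_eq_square algebra_simps)
    from this[of "c a * f a x" "F x" for x]
    show "AE x in \<mu>. norm ((c a * f a x + F x)\<^sup>2) \<le> norm (2 * (c a)\<^sup>2 * (f a x)\<^sup>2 + 2 * (F x)\<^sup>2)"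
      by (simp add: power_mult_distrib mult.assoc)
  qed (use F a in measurable)
  then show ?case
    using insert.hyps F a by (simp add: L2_space_def F_def)
qed

lemma coord_deg_le_sum:
  assumes "f \<in> coord_deg_le N \<mu> D"
  obtains T c where "finite T" "\<forall>a\<in>T. \<exists>J\<subseteq>{1..N}. card J \<le> D \<and> a \<in> coord_space \<mu> J"
    "f = (\<lambda>x. \<Sum>a\<in>T. c a * a x)"
proof -
  interpret vector_space "\<lambda>(c :: real) (f :: (nat \<Rightarrow> real) \<Rightarrow> real). \<lambda>x. c * f x"
    by (rule real_fun_vector_space)
  obtain T c where T: "finite T" "T \<subseteq> (\<Union>J\<in>{J. J \<subseteq> {1..N} \<and> card J \<le> D}. coord_space \<mu> J)"
      "f = (\<Sum>a\<in>T. (\<lambda>x. c a * a x))"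
    using assms unfolding coord_deg_le_def span_explicit by auto
  have "(\<Sum>a\<in>T. (\<lambda>x. c a * a x)) = (\<lambda>x. \<Sum>a\<in>T. c a * a x)"
    using T(1) by (induction T rule: finite_induct) (auto simp: fun_eq_iff)
  then show thesis
    using T by (intro that[of T c]) auto
qed

lemma coord_deg_le_L2:
  assumes "f \<in> coord_deg_le N \<mu> D"
  shows "f \<in> L2_space \<mu>"
proof (rule coord_deg_le_sum[OF assms])
  fix T c
  assume T: "finite T" "\<forall>a\<in>T. \<exists>J\<subseteq>{1..N}. card J \<le> D \<and> a \<in> coord_space \<mu> J"
    and f: "f = (\<lambda>x. \<Sum>a\<in>T. c a * a x)"
  have "a \<in> L2_space \<mu>" if "a \<in> T" for a
    using T(2) that by (auto simp: coord_space_def)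
  then show ?thesis
    unfolding f by (intro L2_space_sum[OF T(1)])
qed

text \<open>Each summand is replaced by a function that literally reads the coordinates in
  \<open>J a\<close>, since \<open>sum_nn_integral_difference_le\<close> asks for invariance at
  every point and not only almost everywhere.\<close>

lemma coord_deg_le_AE:
  assumes "f \<in> coord_deg_le N \<mu> D"
  obtains T :: "((nat \<Rightarrow> real) \<Rightarrow> real) set" and J h where "finite T"
    "\<forall>a\<in>T. J a \<subseteq> {1..N} \<and> card (J a) \<le> D \<and> h a \<in> borel_measurable (RN (J a))"
    "AE x in \<mu>. f x = (\<Sum>a\<in>T. h a (restrict x (J a)))"
proof -
  obtain T c where T: "finite T" "\<forall>a\<in>T. \<exists>J\<subseteq>{1..N}. card J \<le> D \<and> a \<in> coord_space \<mu> J"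
    "f = (\<lambda>x. \<Sum>a\<in>T. c a * a x)"
    by (rule coord_deg_le_sum[OF assms]) (rule that)
  have "\<forall>a\<in>T. \<exists>J h. J \<subseteq> {1..N} \<and> card J \<le> D \<and> h \<in> borel_measurable (RN J) \<and>
      (AE x in \<mu>. a x = h (restrict x J))"
    using T(2) unfolding coord_space_def by blast
  from bchoice[OF this] obtain J where "\<forall>a\<in>T. \<exists>h. J a \<subseteq> {1..N} \<and> card (J a) \<le> D \<and>
      h \<in> borel_measurable (RN (J a)) \<and> (AE x in \<mu>. a x = h (restrict x (J a)))" ..
  from bchoice[OF this] obtain h where h: "\<forall>a\<in>T. J a \<subseteq> {1..N} \<and> card (J a) \<le> D \<and>
      h a \<in> borel_measurable (RN (J a)) \<and> (AE x in \<mu>. a x = h a (restrict x (J a)))" ..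
  have "AE x in \<mu>. \<forall>a\<in>T. a x = h a (restrict x (J a))"
    using h T(1) by (intro AE_finite_allI) auto
  then have "AE x in \<mu>. f x = (\<Sum>a\<in>T. c a * h a (restrict x (J a)))"
    by eventually_elim (simp add: T(3))
  then show thesis
    by (rule that[of T J "\<lambda>a x. c a * h a x", rotated 2]) (use h T(1) in auto)
qed

text \<open>On pairs of independent copies, resampling coordinate \<open>i\<close> of the first copy
  is the exchange of the two \<open>i\<close>-th coordinates. A summand that depends on
  \<open>J a\<close> is fixed by the exchanges outside \<open>J a\<close>, so
  \<open>sum_nn_integral_difference_le\<close> bounds this total influence. The factor 4 undoes the
  halves there.\<close>

lemma sum_influence_le:
  fixes M :: "nat \<Rightarrow> real measure"
  assumes prob: "\<And>i. prob_space (M i)" and borel: "\<And>i. sets (M i) = sets borel"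
    and I: "I = {1..N}" and f: "f \<in> coord_deg_le N (PiM I M) D"
  shows "(\<Sum>i\<in>I. \<integral>\<^sup>+x. (\<integral>\<^sup>+x'. ennreal ((f x - f (x(i := x' i)))\<^sup>2) \<partial>PiM I M) \<partial>PiM I M)
    \<le> ennreal (4 * real D) * (\<integral>\<^sup>+x. ennreal ((f x)\<^sup>2) \<partial>PiM I M)"
proof -
  interpret product_prob_space M I
    using prob by (rule product_prob_spaceI)
  note [measurable_cong] = borel
  let ?P = "PiM I M \<Otimes>\<^sub>M PiM I M"
  define r where "r i = (\<lambda>(x :: nat \<Rightarrow> real, x' :: nat \<Rightarrow> real). (x(i := x' i), x'(i := x i)))" for i :: nat
  have [simp]: "finite I" by (simp add: I)
  have fm[measurable]: "f \<in> borel_measurable (PiM I M)"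
    using coord_deg_le_L2[OF f] by (simp add: L2_space_def)
  have distr_r: "distr ?P ?P (r i) = ?P" if "i \<in> I" for i
    unfolding r_def using that by (intro distr_swap_coordinate) auto
  have upd[measurable]: "(\<lambda>p. (g p)(i := h p)) \<in> L \<rightarrow>\<^sub>M PiM I M"
    if "g \<in> L \<rightarrow>\<^sub>M PiM I M" "h \<in> L \<rightarrow>\<^sub>M M i" "i \<in> I" for g h i and L :: "'l measure"
    using measurable_compose[OF measurable_Pair[OF that(1,2)] measurable_add_dim[of i I M]] that(3)
    by (simp add: insert_absorb)
  have comp: "(\<lambda>x. x i) \<in> borel_measurable (PiM I M)" if "i \<in> I" for i
    using measurable_component_singleton[OF that, of M] measurable_cong_sets[OF refl borel] by blast
  have r_m: "r i \<in> ?P \<rightarrow>\<^sub>M ?P" if [measurable]: "i \<in> I" for i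
    unfolding r_def split_beta' by measurable
  obtain T :: "((nat \<Rightarrow> real) \<Rightarrow> real) set" and J h where T: "finite T"
    "\<forall>a\<in>T. J a \<subseteq> {1..N} \<and> card (J a) \<le> D \<and> h a \<in> borel_measurable (RN (J a))"
    "AE x in PiM I M. f x = (\<Sum>a\<in>T. h a (restrict x (J a)))"
    by (rule coord_deg_le_AE[OF f]) (rule that)
  define F where "F a p = h a (restrict (fst p) (J a))" for a and p :: "(nat \<Rightarrow> real) \<times> (nat \<Rightarrow> real)"
  have F[measurable]: "F a \<in> borel_measurable ?P" if a: "a \<in> T" for a
  proof -
    have "(\<lambda>p. restrict (fst p) (J a)) \<in> ?P \<rightarrow>\<^sub>M RN (J a)"
      using T(2) a I by (intro measurable_restrict measurable_compose[OF measurable_fst] comp) blast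
    moreover have "h a \<in> borel_measurable (RN (J a))"
      using T(2) a by blast
    ultimately show ?thesis
      unfolding F_def by (rule measurable_compose)
  qed
  \<comment> \<open>The representation of \<open>f\<close> holds only almost surely. It is carried
    to pairs through the first marginal, and later to exchanged pairs because \<open>r i\<close>
    preserves their law.\<close>
  have AE: "AE p in ?P. f (fst p) = (\<Sum>a\<in>T. F a p)"
    unfolding F_def by (rule AE_distrD[OF measurable_fst]) (unfold P.distr_pair_fst, rule T(3))
  have key: "(\<Sum>i\<in>I. \<integral>\<^sup>+p. ennreal ((((\<Sum>a\<in>T. F a p) - (\<Sum>a\<in>T. F a (r i p))) / 2)\<^sup>2) \<partial>?P)
      \<le> of_nat D * (\<integral>\<^sup>+p. ennreal ((\<Sum>a\<in>T. F a p)\<^sup>2) \<partial>?P)"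
  proof (rule sum_nn_integral_difference_le)
    show "r i (r j p) = r j (r i p)" for i j p
      by (cases p) (auto simp: r_def fun_eq_iff)
    show "card (J a \<inter> I) \<le> D" if "a \<in> T" for a
      using T(2) that I Int_absorb2[of "J a" I] by metis
    show "F a (r i p) = F a p" if "i \<in> I - J a" for a i p
      using that by (auto simp: F_def r_def split_beta' restrict_def fun_eq_iff intro!: arg_cong[of _ _ "h a"])
  qed (use T(1) r_m distr_r F in auto)
  have "(\<Sum>i\<in>I. \<integral>\<^sup>+x. (\<integral>\<^sup>+x'. ennreal ((f x - f (x(i := x' i)))\<^sup>2) \<partial>PiM I M) \<partial>PiM I M)
      = (\<Sum>i\<in>I. 4 * (\<integral>\<^sup>+p. ennreal ((((\<Sum>a\<in>T. F a p) - (\<Sum>a\<in>T. F a (r i p))) / 2)\<^sup>2) \<partial>?P))"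
  proof (rule sum.cong[OF refl])
    fix i assume i: "i \<in> I"
    have [measurable]: "(\<lambda>p. F a (r i p)) \<in> borel_measurable ?P" if "a \<in> T" for a
      using r_m[OF i] F[OF that] by (rule measurable_compose)
    have fr: "(\<lambda>p. f (fst (r i p))) \<in> borel_measurable ?P"
      using measurable_compose[OF measurable_compose[OF r_m[OF i] measurable_fst] fm] .
    have fr2: "(\<lambda>p. ennreal ((f (fst p) - f (fst (r i p)))\<^sup>2)) \<in> borel_measurable ?P"
      by (rule measurable_compose[OF borel_measurable_diff[OF measurable_compose[OF measurable_fst fm] fr],
            of "\<lambda>t. ennreal (t\<^sup>2)"]) measurable
    have "AE p in ?P. f (fst (r i p)) = (\<Sum>a\<in>T. F a (r i p))"
      using AE_distrD[OF r_m[OF i]] AE unfolding distr_r[OF i] by blast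
    with AE have "AE p in ?P. ennreal ((f (fst p) - f (fst (r i p)))\<^sup>2)
        = 4 * ennreal ((((\<Sum>a\<in>T. F a p) - (\<Sum>a\<in>T. F a (r i p))) / 2)\<^sup>2)"
      by eventually_elim (simp add: power_divide ennreal_mult'[symmetric] flip: ennreal_numeral)
    then have "(\<integral>\<^sup>+p. ennreal ((f (fst p) - f (fst (r i p)))\<^sup>2) \<partial>?P)
        = (\<integral>\<^sup>+p. 4 * ennreal ((((\<Sum>a\<in>T. F a p) - (\<Sum>a\<in>T. F a (r i p))) / 2)\<^sup>2) \<partial>?P)"
      by (rule nn_integral_cong_AE)
    also have "\<dots> = 4 * (\<integral>\<^sup>+p. ennreal ((((\<Sum>a\<in>T. F a p) - (\<Sum>a\<in>T. F a (r i p))) / 2)\<^sup>2) \<partial>?P)"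
      by (intro nn_integral_cmult) measurable
    also have "(\<integral>\<^sup>+p. ennreal ((f (fst p) - f (fst (r i p)))\<^sup>2) \<partial>?P)
        = (\<integral>\<^sup>+x. (\<integral>\<^sup>+x'. ennreal ((f x - f (x(i := x' i)))\<^sup>2) \<partial>PiM I M) \<partial>PiM I M)"
      by (subst P.nn_integral_fst[OF fr2, symmetric]) (simp add: r_def)
    finally show "(\<integral>\<^sup>+x. (\<integral>\<^sup>+x'. ennreal ((f x - f (x(i := x' i)))\<^sup>2) \<partial>PiM I M) \<partial>PiM I M)
        = 4 * (\<integral>\<^sup>+p. ennreal ((((\<Sum>a\<in>T. F a p) - (\<Sum>a\<in>T. F a (r i p))) / 2)\<^sup>2) \<partial>?P)" .
  qed
  also have "\<dots> \<le> 4 * (of_nat D * (\<integral>\<^sup>+p. ennreal ((\<Sum>a\<in>T. F a p)\<^sup>2) \<partial>?P))"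
    unfolding sum_distrib_left[symmetric] by (intro mult_left_mono key) simp
  also have "(\<integral>\<^sup>+p. ennreal ((\<Sum>a\<in>T. F a p)\<^sup>2) \<partial>?P) = (\<integral>\<^sup>+p. ennreal ((f (fst p))\<^sup>2) \<partial>?P)"
  proof (rule nn_integral_cong_AE)
    from AE show "AE p in ?P. ennreal ((\<Sum>a\<in>T. F a p)\<^sup>2) = ennreal ((f (fst p))\<^sup>2)"
      by eventually_elim simp
  qed
  also have "\<dots> = (\<integral>\<^sup>+x. (\<integral>\<^sup>+x'. ennreal ((f x)\<^sup>2) \<partial>PiM I M) \<partial>PiM I M)"
    by (subst P.nn_integral_fst[of "\<lambda>p. ennreal ((f (fst p))\<^sup>2)" "PiM I M", symmetric]) simp_all
  also have "\<dots> = (\<integral>\<^sup>+x. ennreal ((f x)\<^sup>2) \<partial>PiM I M)"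
    by (simp add: P.emeasure_space_1)
  also have "4 * (of_nat D * (\<integral>\<^sup>+x. ennreal ((f x)\<^sup>2) \<partial>PiM I M))
      = ennreal (4 * real D) * (\<integral>\<^sup>+x. ennreal ((f x)\<^sup>2) \<partial>PiM I M)"
    by (subst ennreal_mult) (auto simp: ennreal_of_nat_eq_real_of_nat ac_simps)
  finally show ?thesis .
qed

section \<open>Rounding a real number to a sign\<close>

text \<open>\<open>clip a\<close> is the expected value of the randomized sign of \<open>a\<close>,
  as the threshold is uniform on \<open>{-1..1}\<close>.\<close>

definition clip :: "real \<Rightarrow> real" where
  "clip a = max (-1) (min 1 a)"

text \<open>\<open>flip_prob a\<close> is the probability that the rounding of \<open>a\<close> is the less likely of the two signs.\<close>

definition flip_prob :: "real \<Rightarrow> real" where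
  "flip_prob a = (1 - \<bar>clip a\<bar>) / 2"

abbreviation unif :: "real measure" where
  "unif \<equiv> uniform_measure lborel {-1..1}"

lemma clip_measurable[measurable]: "clip \<in> borel_measurable borel"
  unfolding clip_def[abs_def] by measurable

lemma flip_prob_measurable[measurable]: "flip_prob \<in> borel_measurable borel"
  unfolding flip_prob_def[abs_def] by measurable

lemma sign_pm_measurable[measurable]: "sign_pm \<in> borel_measurable borel"
  unfolding sign_pm_def[abs_def] by measurable

lemma flip_prob_bounds: "0 \<le> flip_prob a" "flip_prob a \<le> 1"
  unfolding flip_prob_def clip_def by auto

lemma sets_unif[measurable_cong, simp]: "sets unif = sets borel"
  by simp

lemma prob_space_unif: "prob_space unif"
  by (rule prob_space_uniform_measure) auto

lemma emeasure_unif_le: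
  assumes "\<And>u. P u \<Longrightarrow> -1 \<le> u \<Longrightarrow> u \<le> 1 \<Longrightarrow> x \<le> u \<and> u \<le> y" "x \<le> y"
    and [measurable]: "Measurable.pred borel P"
  shows "(\<integral>\<^sup>+u. (if P u then 1 else 0) \<partial>unif) \<le> ennreal ((y - x) / 2)"
proof -
  have "(\<integral>\<^sup>+u. (if P u then 1 else 0) \<partial>unif) = (\<integral>\<^sup>+u. indicator {u. P u} u \<partial>unif)"
    by (intro nn_integral_cong) auto
  also have "\<dots> = emeasure unif {u. P u}"
    by (subst nn_integral_indicator) auto
  also have "\<dots> = emeasure lborel ({-1..1} \<inter> {u. P u}) / emeasure lborel {-1..1::real}"
    by (rule emeasure_uniform_measure) auto
  also have "\<dots> \<le> emeasure lborel {x..y} / emeasure lborel {-1..1::real}"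
    using assms(1) by (intro divide_right_mono_ennreal emeasure_mono) auto
  also have "\<dots> = ennreal ((y - x) / 2)"
    using assms(2) by (simp add: divide_ennreal flip: ennreal_numeral)
  finally show ?thesis .
qed

text \<open>The signs differ only for \<open>u\<close> between the clipped values, an event of
  probability \<open>\<bar>clip a - clip b\<bar> / 2\<close>. Low degree controls squared movements
  of the output, so this linear quantity is traded for a square: clipped values of equal sign are at
  most \<open>2 * (flip_prob a + flip_prob b)\<close> apart, and those of opposite sign are handled
  by \<open>d - 1 \<le> d\<^sup>2 / 4\<close>.\<close>

lemma sign_pm_differ_le:
  "(\<integral>\<^sup>+u. (if sign_pm (a - u) \<noteq> sign_pm (b - u) then 1 else 0) \<partial>unif)
    \<le> ennreal (flip_prob a + flip_prob b + (a - b)\<^sup>2 / 4)"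
proof -
  have "(\<integral>\<^sup>+u. (if sign_pm (a - u) \<noteq> sign_pm (b - u) then 1 else 0) \<partial>unif)
      \<le> ennreal ((max (clip a) (clip b) - min (clip a) (clip b)) / 2)"
  proof (rule emeasure_unif_le)
    show "min (clip a) (clip b) \<le> max (clip a) (clip b)"
      by (meson min.cobounded1 max.cobounded1 order_trans)
  qed (auto simp: sign_pm_def clip_def min_le_iff_disj le_max_iff_disj split: if_splits)
  also have "(max (clip a) (clip b) - min (clip a) (clip b)) / 2 = \<bar>clip a - clip b\<bar> / 2"
  proof -
    have "max x y - min x y = \<bar>x - y\<bar>" for x y :: real
      by (simp add: max_def min_def)
    then show ?thesis by simp
  qed
  also have "\<bar>clip a - clip b\<bar> / 2 \<le> flip_prob a + flip_prob b + \<bar>clip a - clip b\<bar>\<^sup>2 / 4"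
  proof -
    have "d - 1 \<le> d\<^sup>2 / 4" for d :: real
      using zero_le_power2[of "d - 2"] by (simp add: power2_eq_square algebra_simps)
    then have sq: "\<bar>clip a - clip b\<bar> - 1 \<le> \<bar>clip a - clip b\<bar>\<^sup>2 / 4" .
    have c: "\<bar>clip a\<bar> \<le> 1" "\<bar>clip b\<bar> \<le> 1"
      by (auto simp: clip_def)
    show ?thesis
    proof (cases "clip a * clip b \<ge> 0")
      case True
      then have "\<bar>clip a - clip b\<bar> = \<bar>\<bar>clip a\<bar> - \<bar>clip b\<bar>\<bar>"
        by (auto simp: zero_le_mult_iff)
      also have "\<dots> \<le> 2 - \<bar>clip a\<bar> - \<bar>clip b\<bar>"
        using c by linarith
      finally have "\<bar>clip a - clip b\<bar> / 2 \<le> flip_prob a + flip_prob b"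
        by (simp add: flip_prob_def field_simps)
      then show ?thesis
        by (rule order_trans) simp
    next
      case False
      \<comment> \<open>With \<open>d\<close> the distance of the clipped values, the two flip
        probabilities sum to \<open>1 - d / 2\<close>, so \<open>d - 1 \<le> d\<^sup>2 / 4\<close>
        is exactly what remains.\<close>
      then have "\<bar>clip a - clip b\<bar> = \<bar>clip a\<bar> + \<bar>clip b\<bar>"
        by (auto simp: not_le mult_less_0_iff)
      with sq show ?thesis
        unfolding flip_prob_def by argo
    qed
  qed
  also have "\<bar>clip a - clip b\<bar>\<^sup>2 \<le> \<bar>a - b\<bar>\<^sup>2"
    by (rule power_mono) (auto simp: clip_def)
  finally show ?thesis
    by (simp add: ennreal_leI)
qed

lemma sign_pm_eq_le:
  "(\<integral>\<^sup>+u. (if sign_pm (a - u) = s then 1 else 0) \<partial>unif) \<le> ennreal (1 - flip_prob a)"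
proof (cases "s = 1")
  case True
  have "(\<integral>\<^sup>+u. (if sign_pm (a - u) = s then 1 else 0) \<partial>unif) \<le> ennreal ((clip a - (-1)) / 2)"
    using True by (intro emeasure_unif_le) (auto simp: sign_pm_def clip_def split: if_splits)
  also have "\<dots> \<le> ennreal (1 - flip_prob a)"
    by (intro ennreal_leI) (auto simp: flip_prob_def field_simps)
  finally show ?thesis .
next
  \<comment> \<open>A value \<open>s\<close> other than the two signs makes the event empty, so the
    estimate for \<open>-1\<close> covers it too.\<close>
  case False
  have "(\<integral>\<^sup>+u. (if sign_pm (a - u) = s then 1 else 0) \<partial>unif) \<le> ennreal ((1 - clip a) / 2)"
    using False by (intro emeasure_unif_le) (auto simp: sign_pm_def clip_def split: if_splits)
  also have "\<dots> \<le> ennreal (1 - flip_prob a)"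
    by (intro ennreal_leI) (auto simp: flip_prob_def field_simps)
  finally show ?thesis .
qed

lemma sign_pm_minority_le:
  "(\<integral>\<^sup>+u. (if sign_pm (a - u) \<noteq> sign_pm a then 1 else 0) \<partial>unif) \<le> ennreal (flip_prob a)"
proof (cases "a > 0")
  case True
  have "(\<integral>\<^sup>+u. (if sign_pm (a - u) \<noteq> sign_pm a then 1 else 0) \<partial>unif) \<le> ennreal ((1 - clip a) / 2)"
    using True by (intro emeasure_unif_le) (auto simp: sign_pm_def clip_def split: if_splits)
  also have "(1 - clip a) / 2 = flip_prob a"
    using True by (auto simp: flip_prob_def clip_def)
  finally show ?thesis .
next
  case False
  have "(\<integral>\<^sup>+u. (if sign_pm (a - u) \<noteq> sign_pm a then 1 else 0) \<partial>unif) \<le> ennreal ((clip a - (-1)) / 2)"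
    using False by (intro emeasure_unif_le) (auto simp: sign_pm_def clip_def split: if_splits)
  also have "(clip a - (-1)) / 2 = flip_prob a"
    using False by (auto simp: flip_prob_def clip_def)
  finally show ?thesis .
qed

text \<open>Add indices one at a time and stop as soon as the sum exceeds \<open>R\<close>: no
  single \<open>q i\<close> exceeds one, so the overshoot is at most one. This provides the block on
  which the randomness is resampled.\<close>

lemma exists_subset_sum_between:
  fixes q :: "'i \<Rightarrow> real"
  assumes "finite I" "\<And>i. i \<in> I \<Longrightarrow> q i \<le> 1" "0 \<le> R" "R < (\<Sum>i\<in>I. q i)"
  shows "\<exists>B\<subseteq>I. R \<le> (\<Sum>i\<in>B. q i) \<and> (\<Sum>i\<in>B. q i) \<le> R + 1"
  using assms
proof (induction I rule: finite_induct)
  case (insert i I)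
  show ?case
  proof (cases "R < (\<Sum>i\<in>I. q i)")
    case True
    then show ?thesis
      using insert.IH insert.prems by (meson insertCI subset_insertI2)
  next
    case False
    then have "(\<Sum>i\<in>insert i I. q i) \<le> R + 1"
      using insert.hyps insert.prems(1)[of i] by simp
    then show ?thesis
      using insert.prems(3) by (intro exI[of _ "insert i I"]) auto
  qed
qed auto

text \<open>Exponential weighting: as \<open>card J \<le> K\<close> and \<open>l \<le> 1\<close>,
  the factor \<open>l ^ card J * (1 / l) ^ K\<close> is at least one. With it inserted, the sum may
  run over all subsets and becomes \<open>(1 + 2 * l) ^ card I * (1 / l) ^ K\<close>. The weight
  \<open>2 ^ card J\<close> counts the sign patterns on \<open>J\<close>.\<close>

lemma sum_two_power_card_le:
  fixes l :: real
  assumes "0 < l" "l \<le> 1" "finite I" "real K \<le> l * card I"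
  shows "(\<Sum>J\<in>{J. J \<subseteq> I \<and> card J \<le> K}. 2 ^ card J) \<le> exp (l * card I * (2 + ln (1 / l)))"
proof -
  have "(\<Sum>J\<in>{J. J \<subseteq> I \<and> card J \<le> K}. 2 ^ card J)
      \<le> (\<Sum>J\<in>{J. J \<subseteq> I \<and> card J \<le> K}. (2 * l) ^ card J * (1 / l) ^ K)"
  proof (rule sum_mono)
    fix J assume "J \<in> {J. J \<subseteq> I \<and> card J \<le> K}"
    then have "(1 / l) ^ card J \<le> (1 / l) ^ K"
      using assms by (intro power_increasing) auto
    then have "(2 * l) ^ card J * (1 / l) ^ card J \<le> (2 * l) ^ card J * (1 / l) ^ K"
      using assms by (intro mult_left_mono) auto
    moreover have "(2 * l) ^ card J * (1 / l) ^ card J = 2 ^ card J"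
      using assms by (simp add: power_mult_distrib power_divide)
    ultimately show "2 ^ card J \<le> (2 * l) ^ card J * (1 / l) ^ K"
      by simp
  qed
  also have "\<dots> \<le> (\<Sum>J\<in>Pow I. (2 * l) ^ card J * (1 / l) ^ K)"
    using assms by (intro sum_mono2) auto
  also have "\<dots> = (1 + 2 * l) ^ card I * (1 / l) ^ K"
    using prod_add[OF assms(3), of "\<lambda>_. 2 * l" "\<lambda>_. 1"]
    by (simp add: sum_distrib_right add.commute)
  also have "\<dots> \<le> exp (2 * l) ^ card I * exp (real K * ln (1 / l))"
  proof (rule mult_mono)
    show "(1 + 2 * l) ^ card I \<le> exp (2 * l) ^ card I"
      using assms exp_ge_add_one_self by (intro power_mono) auto
    show "(1 / l) ^ K \<le> exp (real K * ln (1 / l))"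
      using assms by (simp add: exp_of_nat_mult)
  qed (use assms in auto)
  also have "\<dots> = exp (2 * l * card I + real K * ln (1 / l))"
    using exp_of_nat_mult[of "card I" "2 * l"] by (simp add: exp_add mult.commute)
  also have "\<dots> \<le> exp (l * card I * (2 + ln (1 / l)))"
    using assms mult_right_mono[OF assms(4), of "ln (1 / l)"] by (simp add: algebra_simps)
  finally show ?thesis .
qed

section \<open>Algorithms that leave few coordinates to chance\<close>

abbreviation b2e :: "bool \<Rightarrow> ennreal" where
  "b2e P \<equiv> (if P then 1 else 0)"

lemma sum_b2e: "finite I \<Longrightarrow> (\<Sum>j\<in>I. b2e (P j)) = ennreal (card {j\<in>I. P j})"
  by (simp add: sum.If_cases Int_def ennreal_of_nat_eq_real_of_nat)

text \<open>Pointwise form of Markov's inequality for the number of indices satisfying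
  \<open>P\<close>.\<close>

lemma one_le_inverse_mult_sum_b2e:
  assumes "finite I" "0 < K" "real K \<le> card {j\<in>I. P j}"
  shows "1 \<le> ennreal (1 / real K) * (\<Sum>j\<in>I. b2e (P j))"
  using assms by (simp add: sum_b2e flip: ennreal_mult ennreal_1)

text \<open>\<open>m i\<close> is the law of the \<open>i\<close>-th coordinate of the instance and
  \<open>\<tau>\<close> stands for \<open>2 powr (- E)\<close>. The bounded densities enter as a
  bound on the mass of intervals.\<close>

locale rounded_algorithm =
  fixes I :: "nat set" and m :: "nat \<Rightarrow> real measure" and L \<tau> :: real
    and A :: "(nat \<Rightarrow> real) \<Rightarrow> nat \<Rightarrow> real"
  assumes finite_I: "finite I" and prob_m: "\<And>i. prob_space (m i)"
    and sets_m[measurable_cong]: "\<And>i. sets (m i) = sets borel"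
    and interval_m: "\<And>i a b. i \<in> I \<Longrightarrow> a \<le> b \<Longrightarrow> emeasure (m i) {a..b} \<le> ennreal (L * (b - a))"
    and A_meas: "A \<in> RN I \<rightarrow>\<^sub>M RN I"
    and L_nonneg: "0 \<le> L" and tau_nonneg: "0 \<le> \<tau>"
begin

abbreviation "G \<equiv> PiM I m"
abbreviation "V \<equiv> PiM I (\<lambda>_. unif)"

text \<open>Agrees with \<open>rounding\<close> on the index set, where \<open>discrepancy\<close>
  evaluates it, but is not restricted to that set.\<close>

definition rounded :: "(nat \<Rightarrow> real) \<Rightarrow> (nat \<Rightarrow> real) \<Rightarrow> nat \<Rightarrow> real" where
  "rounded g u j = sign_pm (A g j - u j)"

definition discrepancy :: "(nat \<Rightarrow> real) \<Rightarrow> (nat \<Rightarrow> real) \<Rightarrow> real" where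
  "discrepancy g u = (\<Sum>j\<in>I. g j * rounded g u j)"

definition flips :: "(nat \<Rightarrow> real) \<Rightarrow> real" where
  "flips g = (\<Sum>j\<in>I. flip_prob (A g j))"

sublocale G: product_prob_space m I
  using prob_m by (rule product_prob_spaceI)

sublocale V: product_prob_space "\<lambda>_. unif" I
  using prob_space_unif by (rule product_prob_spaceI)

section \<open>Measurability of the rounding, the discrepancy and the flips\<close>

lemma coord_measurable:
  assumes "f \<in> S \<rightarrow>\<^sub>M RN I" "j \<in> I"
  shows "(\<lambda>p. f p j) \<in> borel_measurable S"
  using measurable_compose[OF assms(1) measurable_component_singleton[OF assms(2)]] .

text \<open>\<open>G\<close> and \<open>V\<close> carry the sigma-algebra of \<open>RN I\<close>;
  measurability rules phrased with \<open>RN I\<close> as target therefore serve both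
  measures.\<close>

lemma to_G: "f \<in> S \<rightarrow>\<^sub>M G \<longleftrightarrow> f \<in> S \<rightarrow>\<^sub>M RN I" and to_V: "f \<in> S \<rightarrow>\<^sub>M V \<longleftrightarrow> f \<in> S \<rightarrow>\<^sub>M RN I"
  by (intro arg_cong2[of _ _ _ _ "(\<in>)"] measurable_cong_sets sets_PiM_cong refl; simp add: sets_m)+

lemma A_measurable:
  assumes "f \<in> S \<rightarrow>\<^sub>M RN I" "j \<in> I"
  shows "(\<lambda>p. A (f p) j) \<in> borel_measurable S"
  by (rule coord_measurable[OF measurable_compose[OF assms(1) A_meas] assms(2)])

lemma rounded_measurable:
  assumes "f \<in> S \<rightarrow>\<^sub>M RN I" "h \<in> S \<rightarrow>\<^sub>M RN I" "j \<in> I"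
  shows "(\<lambda>p. rounded (f p) (h p) j) \<in> borel_measurable S"
  unfolding rounded_def using A_measurable[OF assms(1,3)] coord_measurable[OF assms(2,3)] by measurable

lemma differ_measurable:
  assumes "f \<in> S \<rightarrow>\<^sub>M RN I" "f' \<in> S \<rightarrow>\<^sub>M RN I" "h \<in> S \<rightarrow>\<^sub>M RN I" "j \<in> I"
  shows "(\<lambda>p. b2e (rounded (f p) (h p) j \<noteq> rounded (f' p) (h p) j)) \<in> borel_measurable S"
  using rounded_measurable[OF assms(1,3,4)] rounded_measurable[OF assms(2,3,4)] by measurable

lemma discrepancy_measurable:
  assumes "f \<in> S \<rightarrow>\<^sub>M RN I" "h \<in> S \<rightarrow>\<^sub>M RN I"
  shows "(\<lambda>p. discrepancy (f p) (h p)) \<in> borel_measurable S"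
  unfolding discrepancy_def
  by (intro borel_measurable_sum borel_measurable_times rounded_measurable coord_measurable assms)

lemma flips_measurable:
  assumes "f \<in> S \<rightarrow>\<^sub>M RN I"
  shows "(\<lambda>p. flips (f p)) \<in> borel_measurable S"
  unfolding flips_def using A_measurable[OF assms] by measurable

lemma update_measurable:
  assumes "f \<in> S \<rightarrow>\<^sub>M RN I" "h \<in> borel_measurable S" "i \<in> I"
  shows "(\<lambda>p. (f p)(i := h p)) \<in> S \<rightarrow>\<^sub>M RN I"
  using measurable_compose[OF measurable_Pair[OF assms(1,2)] measurable_add_dim[of i I "\<lambda>_. borel"]] assms(3)
  by (simp add: insert_absorb)

lemma id_measurable: "(\<lambda>g. g) \<in> G \<rightarrow>\<^sub>M RN I" "(\<lambda>u. u) \<in> V \<rightarrow>\<^sub>M RN I"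
  using to_G[of "\<lambda>g. g" G] to_V[of "\<lambda>g. g" V] by simp_all

lemma fst_snd_measurable:
  "fst \<in> G \<Otimes>\<^sub>M X \<rightarrow>\<^sub>M RN I" "snd \<in> X \<Otimes>\<^sub>M G \<rightarrow>\<^sub>M RN I"
  "fst \<in> V \<Otimes>\<^sub>M X \<rightarrow>\<^sub>M RN I" "snd \<in> X \<Otimes>\<^sub>M V \<rightarrow>\<^sub>M RN I"
  using measurable_fst[of G X] measurable_snd[of X G] measurable_fst[of V X] measurable_snd[of X V]
  unfolding to_G to_V by simp_all

lemma const_measurable:
  shows "g \<in> space G \<Longrightarrow> (\<lambda>_. g) \<in> S \<rightarrow>\<^sub>M RN I" and "u \<in> space V \<Longrightarrow> (\<lambda>_. u) \<in> S \<rightarrow>\<^sub>M RN I"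
  using to_G[of "\<lambda>_. g" S] to_V[of "\<lambda>_. u" S] by simp_all

section \<open>Single coordinates and their anti-concentration\<close>

lemma nn_integral_V_component:
  assumes "j \<in> I" "f \<in> borel_measurable borel"
  shows "(\<integral>\<^sup>+u. f (u j) \<partial>V) = (\<integral>\<^sup>+y. f y \<partial>unif)"
proof -
  have "(\<integral>\<^sup>+y. f y \<partial>unif) = (\<integral>\<^sup>+y. f y \<partial>distr V unif (\<lambda>u. u j))"
    by (subst distr_PiM_component) (use assms prob_space_unif in auto)
  also have "\<dots> = (\<integral>\<^sup>+u. f (u j) \<partial>V)"
    using assms by (intro nn_integral_distr measurable_component_singleton) auto
  finally show ?thesis ..
qed

lemma nn_integral_small_ball:
  assumes "i \<in> I" "\<bar>s\<bar> = 1"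
  shows "(\<integral>\<^sup>+y. b2e (\<bar>c + y * s\<bar> \<le> \<tau>) \<partial>m i) \<le> ennreal (2 * L * \<tau>)"
proof -
  have s: "s = 1 \<or> s = -1" using assms(2) by auto
  have "(\<integral>\<^sup>+y. b2e (\<bar>c + y * s\<bar> \<le> \<tau>) \<partial>m i)
      = (\<integral>\<^sup>+y. indicator {- c * s - \<tau> .. - c * s + \<tau>} y \<partial>m i)"
    using s by (intro nn_integral_cong) (auto simp: indicator_def abs_le_iff)
  also have "\<dots> = emeasure (m i) {- c * s - \<tau> .. - c * s + \<tau>}"
    by (rule nn_integral_indicator) (simp add: sets_m)
  also have "\<dots> \<le> ennreal (L * ((- c * s + \<tau>) - (- c * s - \<tau>)))"
    using assms(1) tau_nonneg by (intro interval_m) auto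
  finally show ?thesis by (simp add: mult.commute mult.left_commute)
qed

lemma nn_integral_G_component:
  assumes "i \<in> I" "f \<in> borel_measurable borel"
  shows "(\<integral>\<^sup>+g. f (g i) \<partial>G) = (\<integral>\<^sup>+y. f y \<partial>m i)"
proof -
  have "(\<integral>\<^sup>+y. f y \<partial>m i) = (\<integral>\<^sup>+y. f y \<partial>distr G (m i) (\<lambda>g. g i))"
    by (subst distr_PiM_component) (use assms prob_m in auto)
  also have "\<dots> = (\<integral>\<^sup>+g. f (g i) \<partial>G)"
    using assms by (intro nn_integral_distr measurable_component_singleton) auto
  finally show ?thesis ..
qed

lemma rounded_cases: "rounded g u j = 1 \<or> rounded g u j = -1"
  by (simp add: rounded_def sign_pm_def)

lemma abs_rounded: "\<bar>rounded g u j\<bar> = 1"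
  using rounded_cases[of g u j] by auto


lemma update_indicator_measurable:
  "(\<lambda>t. b2e (\<bar>\<Sum>j\<in>J. (g(i := t)) j * y j\<bar> \<le> \<tau>)) \<in> borel_measurable borel"
proof -
  have [measurable]: "(\<lambda>t. (g(i := t)) j) \<in> borel_measurable borel" for j
    by (cases "j = i") simp_all
  show ?thesis by measurable
qed

text \<open>One fresh coordinate suffices: the other terms form a constant, and \<open>t\<close> has
  to fall into an interval of length \<open>2 * \<tau>\<close>. The signs \<open>y\<close> must be
  fixed before \<open>t\<close> is drawn.\<close>

lemma nn_integral_small_ball_update:
  assumes i: "i \<in> I" and y: "\<And>j. \<bar>y j\<bar> = 1" and g: "g \<in> space G" and J: "J \<subseteq> I" "i \<in> J"
  shows "(\<integral>\<^sup>+t. b2e (\<bar>\<Sum>j\<in>J. (g(i := t)) j * y j\<bar> \<le> \<tau>) \<partial>m i) \<le> ennreal (2 * L * \<tau>)"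
proof -
  have "finite J" using J finite_I finite_subset by blast
  then have "(\<Sum>j\<in>J. (g(i := t)) j * y j) = (\<Sum>j\<in>J - {i}. g j * y j) + t * y i" for t
    using J(2) by (subst sum.remove[of J i]) (auto intro!: sum.cong)
  then show ?thesis
    using nn_integral_small_ball[OF i y, of "\<Sum>j\<in>J - {i}. g j * y j"] by simp
qed

text \<open>The first term covers large, the second small Hamming distance of the two roundings.\<close>

lemma both_solve_le:
  assumes K: "0 < K"
  shows "b2e (flips g \<le> R \<and> \<bar>discrepancy g u\<bar> \<le> \<tau>) * b2e (flips h \<le> R \<and> \<bar>discrepancy h u\<bar> \<le> \<tau>)
    \<le> b2e (flips g \<le> R \<and> flips h \<le> R)
        * (ennreal (1 / real K) * (\<Sum>j\<in>I. b2e (rounded g u j \<noteq> rounded h u j)))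
      + (\<Sum>J\<in>{J. J \<subseteq> I \<and> card J \<le> K}.
          b2e (\<bar>\<Sum>j\<in>I. h j * (if j \<in> J then - rounded g u j else rounded g u j)\<bar> \<le> \<tau>))"
proof (cases "flips g \<le> R \<and> \<bar>discrepancy g u\<bar> \<le> \<tau> \<and> flips h \<le> R \<and> \<bar>discrepancy h u\<bar> \<le> \<tau>")
  case True
  define J where "J = {j \<in> I. rounded g u j \<noteq> rounded h u j}"
  show ?thesis
  proof (cases "card J \<le> K")
    case small: True
    have fin: "finite {J. J \<subseteq> I \<and> card J \<le> K}"
      using finite_I by simp
    \<comment> \<open>The rounding of \<open>h\<close> is the rounding of \<open>g\<close> with the
      signs on \<open>J\<close> flipped. For a given \<open>J\<close> the latter vector does not
      depend on \<open>h\<close>, which makes the small-ball bound applicable after a union over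
      \<open>J\<close>.\<close>
    have "(if j \<in> J then - rounded g u j else rounded g u j) = rounded h u j" if "j \<in> I" for j
      using that rounded_cases[of g u j] rounded_cases[of h u j] by (auto simp: J_def)
    then have "(\<Sum>j\<in>I. h j * (if j \<in> J then - rounded g u j else rounded g u j)) = discrepancy h u"
      unfolding discrepancy_def by (intro sum.cong) auto
    then have "1 = b2e (\<bar>\<Sum>j\<in>I. h j * (if j \<in> J then - rounded g u j else rounded g u j)\<bar> \<le> \<tau>)"
      using True by simp
    also have "\<dots> \<le> (\<Sum>J\<in>{J. J \<subseteq> I \<and> card J \<le> K}.
          b2e (\<bar>\<Sum>j\<in>I. h j * (if j \<in> J then - rounded g u j else rounded g u j)\<bar> \<le> \<tau>))"
      using small fin by (intro member_le_sum[of J]) (auto simp: J_def)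
    finally show ?thesis
      using True by (simp add: add_increasing)
  next
    case False
    then have "1 \<le> ennreal (1 / real K) * (\<Sum>j\<in>I. b2e (rounded g u j \<noteq> rounded h u j))"
      using finite_I K by (intro one_le_inverse_mult_sum_b2e) (auto simp: J_def)
    then show ?thesis
      using True by (simp add: add_increasing2)
  qed
qed auto

lemma expected_distance_le:
  assumes g: "g \<in> space G" and h: "h \<in> space G"
  shows "(\<integral>\<^sup>+u. (\<Sum>j\<in>I. b2e (rounded g u j \<noteq> rounded h u j)) \<partial>V)
    \<le> ennreal (flips g + flips h) + ennreal (1 / 4) * (\<Sum>j\<in>I. ennreal ((A g j - A h j)\<^sup>2))"
proof -
  have "(\<integral>\<^sup>+u. (\<Sum>j\<in>I. b2e (rounded g u j \<noteq> rounded h u j)) \<partial>V)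
      = (\<Sum>j\<in>I. \<integral>\<^sup>+u. b2e (rounded g u j \<noteq> rounded h u j) \<partial>V)"
    by (intro nn_integral_sum differ_measurable const_measurable g h id_measurable)
  also have "\<dots> = (\<Sum>j\<in>I. \<integral>\<^sup>+y. b2e (sign_pm (A g j - y) \<noteq> sign_pm (A h j - y)) \<partial>unif)"
    unfolding rounded_def
    by (intro sum.cong refl nn_integral_V_component[where f = "\<lambda>y. b2e (sign_pm (A g j - y) \<noteq> sign_pm (A h j - y))" for j])
       measurable
  also have "\<dots> \<le> (\<Sum>j\<in>I. ennreal (flip_prob (A g j) + flip_prob (A h j) + (A g j - A h j)\<^sup>2 / 4))"
    by (intro sum_mono sign_pm_differ_le)
  also have "\<dots> = (\<Sum>j\<in>I. ennreal (flip_prob (A g j) + flip_prob (A h j)))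
      + (\<Sum>j\<in>I. ennreal (1 / 4) * ennreal ((A g j - A h j)\<^sup>2))"
    unfolding sum.distrib[symmetric]
    by (intro sum.cong refl) (simp add: flip_prob_bounds flip: ennreal_mult ennreal_plus)
  also have "(\<Sum>j\<in>I. ennreal (flip_prob (A g j) + flip_prob (A h j))) = ennreal (flips g + flips h)"
    by (simp add: flip_prob_bounds flips_def sum.distrib sum_ennreal sum_nonneg)
  finally show ?thesis
    by (simp add: sum_distrib_left del: sum_ennreal)
qed

text \<open>For fixed \<open>u\<close>, the squared probability of solving with few flips is at most
  the probability that the instance and its resampled version both do so; Cauchy-Schwarz carries the
  square through the average over \<open>u\<close>. By \<open>both_solve_le\<close> there remain a
  Markov bound with expected distance at most \<open>2 * R + W\<close> and a union bound over the
  sets \<open>J\<close>.\<close>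

lemma resampled_coordinate_bound:
  assumes K: "0 < K" and R: "0 \<le> R" and W: "0 \<le> W" and i: "i \<in> I"
    and stable: "(\<Sum>j\<in>I. \<integral>\<^sup>+g. (\<integral>\<^sup>+g'. ennreal ((A g j - A (g(i := g' i)) j)\<^sup>2) \<partial>G) \<partial>G) \<le> ennreal (4 * W)"
  shows "(\<integral>\<^sup>+u. (\<integral>\<^sup>+g. b2e (flips g \<le> R \<and> \<bar>discrepancy g u\<bar> \<le> \<tau>) \<partial>G) \<partial>V)\<^sup>2
    \<le> ennreal ((2 * R + W) / K + card {J. J \<subseteq> I \<and> card J \<le> K} * (2 * L * \<tau>))"
proof -
  let ?f = "\<lambda>g u. b2e (flips g \<le> R \<and> \<bar>discrepancy g u\<bar> \<le> \<tau>)"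
  let ?J = "{J. J \<subseteq> I \<and> card J \<le> K}"
  let ?GG = "G \<Otimes>\<^sub>M G"
  let ?h = "\<lambda>p. (fst p)(i := snd p i)"
  let ?near = "\<lambda>g u h. b2e (flips g \<le> R \<and> flips h \<le> R)
        * (ennreal (1 / real K) * (\<Sum>j\<in>I. b2e (rounded g u j \<noteq> rounded h u j)))"
  let ?far = "\<lambda>J g u h. b2e (\<bar>\<Sum>j\<in>I. h j * (if j \<in> J then - rounded g u j else rounded g u j)\<bar> \<le> \<tau>)"
  interpret GG: prob_space ?GG
    by (intro prob_space_pair G.P.prob_space_axioms)
  interpret GV: pair_prob_space ?GG V ..
  note hm = update_measurable[OF fst_snd_measurable(1) coord_measurable[OF fst_snd_measurable(2) i] i]
  note qm = measurable_compose[OF measurable_fst fst_snd_measurable(1)]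
      measurable_compose[OF measurable_fst hm] fst_snd_measurable(4)
  have f_meas: "(\<lambda>p. ?f (fst p) (snd p)) \<in> borel_measurable (G \<Otimes>\<^sub>M V)"
  proof -
    have [measurable]: "(\<lambda>p. flips (fst p)) \<in> borel_measurable (G \<Otimes>\<^sub>M V)"
        "(\<lambda>p. discrepancy (fst p) (snd p)) \<in> borel_measurable (G \<Otimes>\<^sub>M V)"
      by (intro flips_measurable discrepancy_measurable fst_snd_measurable)+
    show ?thesis by measurable
  qed
  have near_meas: "(\<lambda>q. ?near (fst (fst q)) (snd q) (?h (fst q))) \<in> borel_measurable (?GG \<Otimes>\<^sub>M V)"
  proof -
    have [measurable]: "(\<lambda>q. flips (fst (fst q))) \<in> borel_measurable (?GG \<Otimes>\<^sub>M V)"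
        "(\<lambda>q. flips (?h (fst q))) \<in> borel_measurable (?GG \<Otimes>\<^sub>M V)"
      by (intro flips_measurable qm)+
    have [measurable]: "(\<lambda>q. \<Sum>j\<in>I. b2e (rounded (fst (fst q)) (snd q) j \<noteq> rounded (?h (fst q)) (snd q) j))
        \<in> borel_measurable (?GG \<Otimes>\<^sub>M V)"
      by (intro borel_measurable_sum differ_measurable qm)
    show ?thesis by measurable
  qed
  have far_meas: "(\<lambda>q. ?far J (fst (fst q)) (snd q) (?h (fst q))) \<in> borel_measurable (?GG \<Otimes>\<^sub>M V)" for J
  proof -
    have [measurable]: "(\<lambda>q. rounded (fst (fst q)) (snd q) j) \<in> borel_measurable (?GG \<Otimes>\<^sub>M V)"
        "(\<lambda>q. ?h (fst q) j) \<in> borel_measurable (?GG \<Otimes>\<^sub>M V)" if "j \<in> I" for j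
      by (intro rounded_measurable coord_measurable qm that)+
    show ?thesis by measurable
  qed
  let ?H = "\<lambda>p u. ?near (fst p) u (?h p) + (\<Sum>J\<in>?J. ?far J (fst p) u (?h p))"
  have H_meas: "(\<lambda>q. ?H (fst q) (snd q)) \<in> borel_measurable (?GG \<Otimes>\<^sub>M V)"
    by (intro borel_measurable_add near_meas borel_measurable_sum far_meas)
  have to_pair: "(\<integral>\<^sup>+g. (\<integral>\<^sup>+g'. F g (g(i := g' i)) \<partial>G) \<partial>G) = (\<integral>\<^sup>+p. F (fst p) (?h p) \<partial>?GG)"
    if "(\<lambda>p. F (fst p) (?h p)) \<in> borel_measurable ?GG" for F :: "(nat \<Rightarrow> real) \<Rightarrow> (nat \<Rightarrow> real) \<Rightarrow> ennreal"
    using G.P.nn_integral_fst[OF that] by simp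
  have slice: "(\<lambda>p. F p u) \<in> borel_measurable ?GG"
    if "u \<in> space V" "(\<lambda>q. F (fst q) (snd q)) \<in> borel_measurable (?GG \<Otimes>\<^sub>M V)"
    for u and F :: "(nat \<Rightarrow> real) \<times> (nat \<Rightarrow> real) \<Rightarrow> (nat \<Rightarrow> real) \<Rightarrow> ennreal"
    using measurable_compose[OF measurable_Pair2'[OF that(1)] that(2)] by simp
  have override: "override_on g g' {i} = g(i := g' i)" for g g' :: "nat \<Rightarrow> real"
    by (auto simp: override_on_def)
  have "(\<integral>\<^sup>+u. (\<integral>\<^sup>+g. ?f g u \<partial>G) \<partial>V)\<^sup>2 = (\<integral>\<^sup>+u. (\<integral>\<^sup>+g. ?f g u \<partial>G) * 1 \<partial>V)\<^sup>2"
    by simp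
  also have "\<dots> \<le> (\<integral>\<^sup>+u. (\<integral>\<^sup>+g. ?f g u \<partial>G)\<^sup>2 \<partial>V) * (\<integral>\<^sup>+u. 1\<^sup>2 \<partial>V)"
    by (rule Cauchy_Schwarz_nn_integral)
       (use G.P.borel_measurable_nn_integral[OF measurable_pair_swap[OF f_meas]] in simp_all)
  also have "\<dots> = (\<integral>\<^sup>+u. (\<integral>\<^sup>+g. ?f g u \<partial>G)\<^sup>2 \<partial>V)"
    by (simp add: V.P.emeasure_space_1)
  also have "\<dots> \<le> (\<integral>\<^sup>+u. (\<integral>\<^sup>+g. (\<integral>\<^sup>+g'. ?f g u * ?f (g(i := g' i)) u \<partial>G) \<partial>G) \<partial>V)"
  proof (rule nn_integral_mono)
    fix u assume u: "u \<in> space V"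
    have "(\<lambda>g. ?f g u) \<in> borel_measurable G"
      using measurable_compose[OF measurable_Pair2'[OF u] f_meas] by simp
    from G.nn_integral_square_le_resample[OF finite_I _ this, of "{i}"] i
    show "(\<integral>\<^sup>+g. ?f g u \<partial>G)\<^sup>2 \<le> (\<integral>\<^sup>+g. (\<integral>\<^sup>+g'. ?f g u * ?f (g(i := g' i)) u \<partial>G) \<partial>G)"
      by (simp only: override) simp
  qed
  also have "\<dots> \<le> (\<integral>\<^sup>+u. (\<integral>\<^sup>+g. (\<integral>\<^sup>+g'. ?near g u (g(i := g' i)) + (\<Sum>J\<in>?J. ?far J g u (g(i := g' i))) \<partial>G) \<partial>G) \<partial>V)"
    by (intro nn_integral_mono both_solve_le K)
  also have "\<dots> = (\<integral>\<^sup>+u. (\<integral>\<^sup>+p. ?H p u \<partial>?GG) \<partial>V)"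
    by (intro nn_integral_cong to_pair[of "\<lambda>g h. ?near g u h + (\<Sum>J\<in>?J. ?far J g u h)" for u]
          slice[of _ ?H] H_meas)
  also have "\<dots> = (\<integral>\<^sup>+q. ?H (fst q) (snd q) \<partial>(?GG \<Otimes>\<^sub>M V))"
    using GV.nn_integral_snd[OF H_meas] by (simp only: fst_conv snd_conv)
  also have "\<dots> = (\<integral>\<^sup>+q. ?near (fst (fst q)) (snd q) (?h (fst q)) \<partial>(?GG \<Otimes>\<^sub>M V))
      + (\<Sum>J\<in>?J. \<integral>\<^sup>+q. ?far J (fst (fst q)) (snd q) (?h (fst q)) \<partial>(?GG \<Otimes>\<^sub>M V))"
    by (subst nn_integral_add[OF near_meas borel_measurable_sum[OF far_meas]])
       (rule arg_cong[where f = "(+) _"], rule nn_integral_sum[OF far_meas])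
  \<comment> \<open>The two parts are integrated in different orders: over the fresh coordinate
    first for the union bound, where \<open>g\<close> and \<open>u\<close> fix the signs, and over
    \<open>u\<close> first for the expected distance, where both instances are fixed.\<close>
  also have "\<dots> \<le> ennreal ((2 * R + W) / K) + (\<Sum>J\<in>?J. ennreal (2 * L * \<tau>))"
  proof (intro add_mono sum_mono)
    fix J
    have "(\<integral>\<^sup>+q. ?far J (fst (fst q)) (snd q) (?h (fst q)) \<partial>(?GG \<Otimes>\<^sub>M V))
        = (\<integral>\<^sup>+u. (\<integral>\<^sup>+p. ?far J (fst p) u (?h p) \<partial>?GG) \<partial>V)"
      using GV.nn_integral_snd[OF far_meas] by (simp only: fst_conv snd_conv)
    also have "\<dots> = (\<integral>\<^sup>+u. (\<integral>\<^sup>+g. (\<integral>\<^sup>+g'. ?far J g u (g(i := g' i)) \<partial>G) \<partial>G) \<partial>V)"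
      by (intro nn_integral_cong to_pair[of "\<lambda>g h. ?far J g u h" for u, symmetric]
            slice[of _ "\<lambda>p u. ?far J (fst p) u (?h p)"] far_meas)
    also have "\<dots> \<le> (\<integral>\<^sup>+u. (\<integral>\<^sup>+g. ennreal (2 * L * \<tau>) \<partial>G) \<partial>V)"
    proof (intro nn_integral_mono)
      fix u g assume g: "g \<in> space G"
      have "(\<integral>\<^sup>+g'. ?far J g u (g(i := g' i)) \<partial>G) = (\<integral>\<^sup>+t. ?far J g u (g(i := t)) \<partial>m i)"
        by (rule nn_integral_G_component[OF i update_indicator_measurable])
      also have "\<dots> \<le> ennreal (2 * L * \<tau>)"
        using i g by (intro nn_integral_small_ball_update) (auto simp: abs_rounded)
      finally show "(\<integral>\<^sup>+g'. ?far J g u (g(i := g' i)) \<partial>G) \<le> ennreal (2 * L * \<tau>)" .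
    qed
    also have "\<dots> = ennreal (2 * L * \<tau>)"
      by (simp add: G.P.emeasure_space_1 V.P.emeasure_space_1)
    finally show "(\<integral>\<^sup>+q. ?far J (fst (fst q)) (snd q) (?h (fst q)) \<partial>(?GG \<Otimes>\<^sub>M V)) \<le> ennreal (2 * L * \<tau>)" .
  next
    have d_meas[measurable]: "(\<lambda>p. (A (fst p) j - A (?h p) j)\<^sup>2) \<in> borel_measurable ?GG" if "j \<in> I" for j
      using that by (intro borel_measurable_power borel_measurable_diff A_measurable fst_snd_measurable hm)
    have "(\<integral>\<^sup>+q. ?near (fst (fst q)) (snd q) (?h (fst q)) \<partial>(?GG \<Otimes>\<^sub>M V))
        = (\<integral>\<^sup>+p. (\<integral>\<^sup>+u. ?near (fst p) u (?h p) \<partial>V) \<partial>?GG)"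
      using V.P.nn_integral_fst[OF near_meas] by (simp only: fst_conv snd_conv)
    also have "\<dots> \<le> (\<integral>\<^sup>+p. ennreal (1 / real K)
        * (ennreal (2 * R) + ennreal (1 / 4) * (\<Sum>j\<in>I. ennreal ((A (fst p) j - A (?h p) j)\<^sup>2))) \<partial>?GG)"
    proof (rule nn_integral_mono)
      fix p assume p: "p \<in> space ?GG"
      have g: "fst p \<in> space G" "?h p \<in> space G"
        using p i by (auto simp: space_pair_measure space_PiM PiE_iff extensional_def)
      show "(\<integral>\<^sup>+u. ?near (fst p) u (?h p) \<partial>V) \<le> ennreal (1 / real K)
        * (ennreal (2 * R) + ennreal (1 / 4) * (\<Sum>j\<in>I. ennreal ((A (fst p) j - A (?h p) j)\<^sup>2)))"
      proof (cases "flips (fst p) \<le> R \<and> flips (?h p) \<le> R")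
        case True
        then have "(\<integral>\<^sup>+u. ?near (fst p) u (?h p) \<partial>V) = ennreal (1 / real K)
            * (\<integral>\<^sup>+u. (\<Sum>j\<in>I. b2e (rounded (fst p) u j \<noteq> rounded (?h p) u j)) \<partial>V)"
          by (subst nn_integral_cmult[symmetric])
             (simp_all add: borel_measurable_sum differ_measurable const_measurable g id_measurable)
        also have "\<dots> \<le> ennreal (1 / real K) * (ennreal (flips (fst p) + flips (?h p))
            + ennreal (1 / 4) * (\<Sum>j\<in>I. ennreal ((A (fst p) j - A (?h p) j)\<^sup>2)))"
          by (intro mult_left_mono expected_distance_le g) simp
        also have "\<dots> \<le> ennreal (1 / real K)
            * (ennreal (2 * R) + ennreal (1 / 4) * (\<Sum>j\<in>I. ennreal ((A (fst p) j - A (?h p) j)\<^sup>2)))"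
          using True by (intro mult_left_mono add_right_mono ennreal_leI) auto
        finally show ?thesis .
      qed auto
    qed
    also have "\<dots> = ennreal (1 / real K) * (ennreal (2 * R)
        + ennreal (1 / 4) * (\<Sum>j\<in>I. \<integral>\<^sup>+p. ennreal ((A (fst p) j - A (?h p) j)\<^sup>2) \<partial>?GG))"
      by (simp add: nn_integral_cmult nn_integral_add nn_integral_sum GG.emeasure_space_1 del: sum_ennreal)
    also have "(\<Sum>j\<in>I. \<integral>\<^sup>+p. ennreal ((A (fst p) j - A (?h p) j)\<^sup>2) \<partial>?GG)
        = (\<Sum>j\<in>I. \<integral>\<^sup>+g. (\<integral>\<^sup>+g'. ennreal ((A g j - A (g(i := g' i)) j)\<^sup>2) \<partial>G) \<partial>G)"
      by (intro sum.cong refl to_pair[of "\<lambda>g h. ennreal ((A g j - A h j)\<^sup>2)" for j, symmetric]) measurable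
    \<comment> \<open>The 4 in \<open>stable\<close>, inherited from the influence bound, cancels
      the 1/4 that stems from \<open>sign_pm_differ_le\<close>.\<close>
    also have "ennreal (1 / real K) * (ennreal (2 * R) + ennreal (1 / 4) * \<dots>)
        \<le> ennreal (1 / real K) * (ennreal (2 * R) + ennreal (1 / 4) * ennreal (4 * W))"
      by (intro mult_left_mono add_left_mono stable) auto
    also have "\<dots> = ennreal ((2 * R + W) / K)"
      using R W by (simp flip: ennreal_mult ennreal_plus)
    finally show "(\<integral>\<^sup>+q. ?near (fst (fst q)) (snd q) (?h (fst q)) \<partial>(?GG \<Otimes>\<^sub>M V)) \<le> ennreal ((2 * R + W) / K)" .
  qed
  also have "\<dots> = ennreal ((2 * R + W) / K + card ?J * (2 * L * \<tau>))"
    using L_nonneg tau_nonneg R W K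
    by (simp add: ennreal_of_nat_eq_real_of_nat flip: ennreal_mult)
  finally show ?thesis .
qed

end

section \<open>Algorithms that leave many coordinates to chance\<close>

context rounded_algorithm
begin

text \<open>If no short signed subsum of \<open>g\<close> is small, then two distinct solutions are far apart: their
  difference is twice such a subsum.\<close>

definition separated :: "nat \<Rightarrow> (nat \<Rightarrow> real) \<Rightarrow> bool" where
  "separated K g \<longleftrightarrow> (\<forall>J\<subseteq>I. J \<noteq> {} \<longrightarrow> card J \<le> K \<longrightarrow>
    (\<forall>S\<subseteq>J. \<tau> < \<bar>\<Sum>j\<in>J. g j * (if j \<in> S then 1 else -1)\<bar>))"

lemma separated_distance:
  assumes sep: "separated K g"
    and "\<bar>discrepancy g u\<bar> \<le> \<tau>" "\<bar>discrepancy g v\<bar> \<le> \<tau>"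
    and J: "J = {j \<in> I. rounded g u j \<noteq> rounded g v j}" "J \<noteq> {}"
  shows "K < card J"
proof (rule ccontr)
  assume "\<not> K < card J"
  then have JI: "J \<subseteq> I" "card J \<le> K"
    using J by auto
  define S where "S = {j \<in> J. rounded g u j = 1}"
  have "S \<subseteq> J"
    by (auto simp: S_def)
  with JI J(2) have "\<tau> < \<bar>\<Sum>j\<in>J. g j * (if j \<in> S then 1 else -1)\<bar>"
    using sep unfolding separated_def by blast
  moreover have "(\<Sum>j\<in>J. g j * (if j \<in> S then 1 else -1)) * 2 = discrepancy g u - discrepancy g v"
  proof -
    have "(\<Sum>j\<in>J. g j * (if j \<in> S then 1 else -1)) * 2
        = (\<Sum>j\<in>J. g j * rounded g u j - g j * rounded g v j)"
      unfolding sum_distrib_right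
    proof (rule sum.cong[OF refl])
      fix j assume "j \<in> J"
      then show "g j * (if j \<in> S then 1 else -1) * 2 = g j * rounded g u j - g j * rounded g v j"
        using rounded_cases[of g u j] rounded_cases[of g v j] by (auto simp: J S_def)
    qed
    also have "\<dots> = (\<Sum>j\<in>I. g j * rounded g u j - g j * rounded g v j)"
      using finite_I by (intro sum.mono_neutral_left) (auto simp: J)
    finally show ?thesis
      by (simp add: discrepancy_def sum_subtractf)
  qed
  ultimately show False
    using assms(2,3) by linarith
qed

lemma separated_measurable: "(\<lambda>g. b2e (\<not> separated K g)) \<in> borel_measurable G"
proof -
  have "{g \<in> space G. \<tau> < \<bar>\<Sum>j\<in>J. g j * (if j \<in> S then 1 else -1)\<bar>} \<in> sets G" if "J \<subseteq> I" for J S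
  proof -
    have [measurable]: "(\<lambda>g. g j) \<in> borel_measurable G" if "j \<in> J" for j
      using that \<open>J \<subseteq> I\<close> by (intro coord_measurable id_measurable) auto
    show ?thesis by measurable
  qed
  then have "{g \<in> space G. \<forall>J\<in>{J. J \<subseteq> I \<and> J \<noteq> {} \<and> card J \<le> K}. \<forall>S\<in>Pow J.
      \<tau> < \<bar>\<Sum>j\<in>J. g j * (if j \<in> S then 1 else -1)\<bar>} \<in> sets G"
    using finite_I by (intro sets.sets_Collect_finite_All) (auto intro: finite_subset)
  also have "{g \<in> space G. \<forall>J\<in>{J. J \<subseteq> I \<and> J \<noteq> {} \<and> card J \<le> K}. \<forall>S\<in>Pow J.
      \<tau> < \<bar>\<Sum>j\<in>J. g j * (if j \<in> S then 1 else -1)\<bar>} = {g \<in> space G. separated K g}"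
    unfolding separated_def by blast
  finally show ?thesis
    by simp
qed

text \<open>Union bound over the nonempty \<open>J\<close> and the sign patterns
  \<open>S \<subseteq> J\<close>: a nonempty \<open>J\<close> has a coordinate to which the
  small-ball estimate applies. The empty set is put back at the end, which only enlarges the
  bound.\<close>

lemma not_separated_le:
  "(\<integral>\<^sup>+g. b2e (\<not> separated K g) \<partial>G)
    \<le> ennreal ((\<Sum>J\<in>{J. J \<subseteq> I \<and> card J \<le> K}. 2 ^ card J) * (2 * L * \<tau>))"
proof -
  let ?J = "{J. J \<subseteq> I \<and> card J \<le> K} - {{}}"
  let ?b = "\<lambda>J S g. b2e (\<bar>\<Sum>j\<in>J. g j * (if j \<in> S then 1 else -1)\<bar> \<le> \<tau>)"
  have fin: "finite {J. J \<subseteq> I \<and> card J \<le> K}" "\<And>J. J \<in> ?J \<Longrightarrow> finite (Pow J)"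
    using finite_I by (auto intro: finite_subset)
  have b_meas: "?b J S \<in> borel_measurable G" if "J \<in> ?J" for J S
  proof -
    have [measurable]: "(\<lambda>g. g j) \<in> borel_measurable G" if "j \<in> J" for j
      using that \<open>J \<in> ?J\<close> by (intro coord_measurable id_measurable) auto
    show ?thesis by measurable
  qed
  have "b2e (\<not> separated K g) \<le> (\<Sum>J\<in>?J. \<Sum>S\<in>Pow J. ?b J S g)" for g
  proof (cases "separated K g")
    case False
    then obtain J S where "J \<subseteq> I" "J \<noteq> {}" "card J \<le> K" "S \<subseteq> J"
        "\<not> \<tau> < \<bar>\<Sum>j\<in>J. g j * (if j \<in> S then 1 else -1)\<bar>"
      unfolding separated_def by blast
    then have JS: "J \<in> ?J" "S \<in> Pow J" "?b J S g = 1"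
      by (simp_all add: not_less)
    have "1 = ?b J S g"
      using JS by simp
    also have "\<dots> \<le> (\<Sum>S\<in>Pow J. ?b J S g)"
      using JS fin by (intro member_le_sum[of S]) auto
    also have "\<dots> \<le> (\<Sum>J\<in>?J. \<Sum>S\<in>Pow J. ?b J S g)"
      using JS fin by (intro member_le_sum[of J "?J" "\<lambda>J. \<Sum>S\<in>Pow J. ?b J S g"]) auto
    finally show ?thesis
      using False by simp
  qed simp
  then have "(\<integral>\<^sup>+g. b2e (\<not> separated K g) \<partial>G) \<le> (\<integral>\<^sup>+g. (\<Sum>J\<in>?J. \<Sum>S\<in>Pow J. ?b J S g) \<partial>G)"
    by (intro nn_integral_mono)
  also have "\<dots> = (\<Sum>J\<in>?J. \<integral>\<^sup>+g. (\<Sum>S\<in>Pow J. ?b J S g) \<partial>G)"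
    by (intro nn_integral_sum borel_measurable_sum b_meas)
  also have "\<dots> = (\<Sum>J\<in>?J. \<Sum>S\<in>Pow J. \<integral>\<^sup>+g. ?b J S g \<partial>G)"
    by (intro sum.cong refl nn_integral_sum b_meas)
  also have "\<dots> \<le> (\<Sum>J\<in>?J. \<Sum>S\<in>Pow J. ennreal (2 * L * \<tau>))"
  proof (intro sum_mono)
    fix J S assume J: "J \<in> ?J"
    then obtain i where i: "i \<in> J" "i \<in> I" "J \<subseteq> I" by blast
    have "(\<integral>\<^sup>+g. ?b J S g \<partial>G) = (\<integral>\<^sup>+g. (\<integral>\<^sup>+t. ?b J S (g(i := t)) \<partial>m i) \<partial>G)"
      by (rule G.nn_integral_resample_coordinate[OF finite_I i(2) b_meas[OF J], symmetric])
    also have "\<dots> \<le> (\<integral>\<^sup>+g. ennreal (2 * L * \<tau>) \<partial>G)"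
      using i by (intro nn_integral_mono nn_integral_small_ball_update) auto
    finally show "(\<integral>\<^sup>+g. ?b J S g \<partial>G) \<le> ennreal (2 * L * \<tau>)"
      by (simp add: G.P.emeasure_space_1)
  qed
  also have "\<dots> = ennreal ((\<Sum>J\<in>?J. 2 ^ card J) * (2 * L * \<tau>))"
    using L_nonneg tau_nonneg fin(2)
    by (simp add: card_Pow sum_distrib_right ennreal_of_nat_eq_real_of_nat finite_Pow_iff flip: ennreal_mult)
  also have "\<dots> \<le> ennreal ((\<Sum>J\<in>{J. J \<subseteq> I \<and> card J \<le> K}. 2 ^ card J) * (2 * L * \<tau>))"
    using L_nonneg tau_nonneg fin(1) by (intro ennreal_leI mult_right_mono sum_mono2) auto
  finally show ?thesis .
qed

text \<open>Resample \<open>u\<close> on a block \<open>B\<close> with between \<open>R\<close> and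
  \<open>R + 1\<close> expected flips. If both roundings solve, separation leaves two cases. Either
  they agree on \<open>B\<close>, with probability at most the product of the
  \<open>1 - flip_prob (A g j)\<close> and hence at most \<open>exp (- R)\<close>; or they differ in
  more than \<open>K\<close> places of \<open>B\<close>, so that old and new randomness together
  produce more than \<open>K\<close> minority signs there, against an expectation of at most
  \<open>2 * (R + 1)\<close>.\<close>

lemma many_flips_bound:
  assumes K: "0 < K" and R: "0 \<le> R" and g: "g \<in> space G" "separated K g" "R < flips g"
  shows "(\<integral>\<^sup>+u. b2e (\<bar>discrepancy g u\<bar> \<le> \<tau>) \<partial>V)\<^sup>2 \<le> ennreal (exp (- R) + 2 * (R + 1) / K)"
proof -
  let ?f = "\<lambda>u. b2e (\<bar>discrepancy g u\<bar> \<le> \<tau>)"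
  obtain B where B: "B \<subseteq> I" "R \<le> (\<Sum>j\<in>B. flip_prob (A g j))" "(\<Sum>j\<in>B. flip_prob (A g j)) \<le> R + 1"
    using exists_subset_sum_between[OF finite_I, of "\<lambda>j. flip_prob (A g j)" R] flip_prob_bounds R g(3)
    unfolding flips_def by auto
  \<comment> \<open>\<open>?same u v\<close> indicates that \<open>v\<close> reproduces the signs of
    \<open>u\<close> on \<open>B\<close>; the factors one outside \<open>B\<close> make it a product
    over all of \<open>I\<close>, as integration against \<open>V\<close> requires.
    \<open>?minor u\<close> counts the less likely signs in \<open>B\<close>.\<close>
  let ?same = "\<lambda>u v. \<Prod>j\<in>I. (if j \<in> B then b2e (sign_pm (A g j - v j) = rounded g u j) else 1)"
  let ?minor = "\<lambda>u. \<Sum>j\<in>B. b2e (rounded g u j \<noteq> sign_pm (A g j))"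
  have finB: "finite B" using B finite_I finite_subset by blast
  have disc[measurable]: "(\<lambda>u. discrepancy g u) \<in> borel_measurable V"
    by (intro discrepancy_measurable const_measurable g id_measurable)
  have rm: "(\<lambda>u. rounded g u j) \<in> borel_measurable V" if "j \<in> I" for j
    by (intro rounded_measurable const_measurable g id_measurable that)
  have f_meas: "?f \<in> borel_measurable V"
    by measurable
  have minor_meas: "?minor \<in> borel_measurable V"
  proof (rule borel_measurable_sum)
    fix j assume "j \<in> B"
    then have [measurable]: "(\<lambda>u. rounded g u j) \<in> borel_measurable V"
      using rm B by blast
    show "(\<lambda>u. b2e (rounded g u j \<noteq> sign_pm (A g j))) \<in> borel_measurable V"
      by measurable
  qed
  have comp: "(\<lambda>v. v j) \<in> borel_measurable V" if "j \<in> I" for j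
    by (intro coord_measurable id_measurable that)
  have same_meas: "(\<lambda>v. ?same u v) \<in> borel_measurable V" for u
  proof (rule borel_measurable_prod_ennreal)
    fix j assume "j \<in> I"
    note [measurable] = comp[OF this]
    show "(\<lambda>v. if j \<in> B then b2e (sign_pm (A g j - v j) = rounded g u j) else 1) \<in> borel_measurable V"
      by measurable
  qed
  have pointwise: "?f u * ?f (override_on u v B) \<le> ?same u v + ennreal (1 / real K) * (?minor u + ?minor v)" for u v
  proof (cases "\<bar>discrepancy g u\<bar> \<le> \<tau> \<and> \<bar>discrepancy g (override_on u v B)\<bar> \<le> \<tau>")
    case True
    let ?w = "override_on u v B"
    define J where "J = {j \<in> I. rounded g u j \<noteq> rounded g ?w j}"
    have w: "rounded g ?w j = (if j \<in> B then rounded g v j else rounded g u j)" for j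
      by (auto simp: rounded_def override_on_def)
    show ?thesis
    proof (cases "J = {}")
      case eq: True
      have "?same u v = (\<Prod>j\<in>I. 1)"
        using eq B by (intro prod.cong) (auto simp: J_def w rounded_def)
      then show ?thesis
        using True by (simp add: add_increasing2)
    next
      case False
      then have "K < card J"
        using True by (intro separated_distance[OF g(2)]) (auto simp: J_def)
      moreover have "J = {j \<in> B. rounded g u j \<noteq> rounded g v j}"
        using B by (auto simp: J_def w)
      ultimately have "1 \<le> ennreal (1 / real K) * (\<Sum>j\<in>B. b2e (rounded g u j \<noteq> rounded g v j))"
        using finB K by (intro one_le_inverse_mult_sum_b2e) auto
      \<comment> \<open>Two different signs cannot both equal the majority sign.\<close>
      also have "\<dots> \<le> ennreal (1 / real K) * (?minor u + ?minor v)"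
        unfolding sum.distrib[symmetric] by (intro mult_left_mono sum_mono) auto
      finally show ?thesis
        using True by (simp add: add_increasing)
    qed
  qed auto
  have same_le: "(\<integral>\<^sup>+v. ?same u v \<partial>V) \<le> ennreal (exp (- R))" for u
  proof -
    have "(\<integral>\<^sup>+v. ?same u v \<partial>V)
        = (\<Prod>j\<in>I. \<integral>\<^sup>+y. (if j \<in> B then b2e (sign_pm (A g j - y) = rounded g u j) else 1) \<partial>unif)"
      by (rule V.product_nn_integral_prod[OF finite_I,
            where f = "\<lambda>j y. if j \<in> B then b2e (sign_pm (A g j - y) = rounded g u j) else 1"]) measurable
    also have "\<dots> = (\<Prod>j\<in>B. \<integral>\<^sup>+y. b2e (sign_pm (A g j - y) = rounded g u j) \<partial>unif)"
      using B finite_I by (intro prod.mono_neutral_cong_right) (auto simp: V.M.emeasure_space_1)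
    also have "\<dots> \<le> (\<Prod>j\<in>B. ennreal (1 - flip_prob (A g j)))"
      by (intro prod_mono_ennreal sign_pm_eq_le)
    also have "\<dots> \<le> (\<Prod>j\<in>B. ennreal (exp (- flip_prob (A g j))))"
    proof (intro prod_mono_ennreal ennreal_leI)
      fix j show "1 - flip_prob (A g j) \<le> exp (- flip_prob (A g j))"
        using exp_ge_add_one_self[of "- flip_prob (A g j)"] by simp
    qed
    also have "\<dots> = ennreal (exp (- (\<Sum>j\<in>B. flip_prob (A g j))))"
      by (simp add: prod_ennreal exp_sum[OF finB, symmetric] sum_negf)
    also have "\<dots> \<le> ennreal (exp (- R))"
      using B by (intro ennreal_leI) auto
    finally show ?thesis .
  qed
  have minor_le: "(\<integral>\<^sup>+u. ?minor u \<partial>V) \<le> ennreal (R + 1)"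
  proof -
    have "(\<integral>\<^sup>+u. ?minor u \<partial>V) = (\<Sum>j\<in>B. \<integral>\<^sup>+u. b2e (rounded g u j \<noteq> sign_pm (A g j)) \<partial>V)"
    proof (rule nn_integral_sum)
      fix j assume "j \<in> B"
      then have [measurable]: "(\<lambda>u. rounded g u j) \<in> borel_measurable V"
        using rm B by blast
      show "(\<lambda>u. b2e (rounded g u j \<noteq> sign_pm (A g j))) \<in> borel_measurable V"
        by measurable
    qed
    also have "\<dots> = (\<Sum>j\<in>B. \<integral>\<^sup>+y. b2e (sign_pm (A g j - y) \<noteq> sign_pm (A g j)) \<partial>unif)"
    proof (rule sum.cong[OF refl])
      fix j assume "j \<in> B"
      then show "(\<integral>\<^sup>+u. b2e (rounded g u j \<noteq> sign_pm (A g j)) \<partial>V)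
          = (\<integral>\<^sup>+y. b2e (sign_pm (A g j - y) \<noteq> sign_pm (A g j)) \<partial>unif)"
        unfolding rounded_def using B
        by (intro nn_integral_V_component[where f = "\<lambda>y. b2e (sign_pm (A g j - y) \<noteq> sign_pm (A g j))"]) auto
    qed
    also have "\<dots> \<le> (\<Sum>j\<in>B. ennreal (flip_prob (A g j)))"
      by (intro sum_mono sign_pm_minority_le)
    also have "\<dots> \<le> ennreal (R + 1)"
      using B flip_prob_bounds by (simp add: ennreal_leI)
    finally show ?thesis .
  qed
  have V_affine: "(\<integral>\<^sup>+v. h v + ennreal (1 / real K) * (a + k v) \<partial>V)
      = (\<integral>\<^sup>+v. h v \<partial>V) + ennreal (1 / real K) * (a + (\<integral>\<^sup>+v. k v \<partial>V))"
    if "h \<in> borel_measurable V" "k \<in> borel_measurable V" for h k and a :: ennreal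
    using that by (simp add: nn_integral_add nn_integral_cmult V.P.emeasure_space_1)
  have "(\<integral>\<^sup>+u. ?f u \<partial>V)\<^sup>2 \<le> (\<integral>\<^sup>+u. (\<integral>\<^sup>+v. ?f u * ?f (override_on u v B) \<partial>V) \<partial>V)"
    by (rule V.nn_integral_square_le_resample[OF finite_I B(1) f_meas])
  also have "\<dots> \<le> (\<integral>\<^sup>+u. (\<integral>\<^sup>+v. ?same u v + ennreal (1 / real K) * (?minor u + ?minor v) \<partial>V) \<partial>V)"
    by (intro nn_integral_mono pointwise)
  also have "\<dots> = (\<integral>\<^sup>+u. (\<integral>\<^sup>+v. ?same u v \<partial>V) + ennreal (1 / real K) * (?minor u + (\<integral>\<^sup>+v. ?minor v \<partial>V)) \<partial>V)"
    by (intro nn_integral_cong V_affine[OF same_meas minor_meas])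
  also have "\<dots> \<le> (\<integral>\<^sup>+u. ennreal (exp (- R)) + ennreal (1 / real K) * (?minor u + ennreal (R + 1)) \<partial>V)"
    by (intro nn_integral_mono add_mono mult_left_mono same_le minor_le) auto
  also have "\<dots> = ennreal (exp (- R)) + ennreal (1 / real K) * ((\<integral>\<^sup>+u. ?minor u \<partial>V) + ennreal (R + 1))"
    using V_affine[OF measurable_const[of "ennreal (exp (- R))"] minor_meas, of "ennreal (R + 1)"]
    by (simp add: add.commute V.P.emeasure_space_1)
  also have "\<dots> \<le> ennreal (exp (- R)) + ennreal (1 / real K) * (ennreal (R + 1) + ennreal (R + 1))"
    by (intro add_mono mult_left_mono minor_le) auto
  also have "\<dots> = ennreal (exp (- R) + 2 * (R + 1) / K)"
    using R by (simp flip: ennreal_mult ennreal_plus)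
  finally show ?thesis .
qed

section \<open>Combining few flips and many flips\<close>

lemma ennreal_le_sqrt:
  assumes "x\<^sup>2 \<le> ennreal c" "0 \<le> c"
  shows "x \<le> ennreal (sqrt c)"
proof (cases x)
  case (real r)
  then have "r\<^sup>2 \<le> c"
    using assms by (simp add: ennreal_power)
  then show ?thesis
    using real by (simp add: ennreal_leI real_le_rsqrt)
next
  case top
  then show ?thesis
    using assms by (simp add: power2_eq_square top_unique)
qed

text \<open>There are three ways to solve: with at most \<open>R\<close> expected flips, giving the
  first square root; on an instance that is not separated, of probability at most \<open>T\<close>;
  or on a separated instance with more flips, giving the last square root.\<close>

lemma solution_probability_le:
  assumes K: "0 < K" and R: "0 \<le> R" and W: "0 \<le> W" and i: "i \<in> I"
    and stable: "(\<Sum>j\<in>I. \<integral>\<^sup>+g. (\<integral>\<^sup>+g'. ennreal ((A g j - A (g(i := g' i)) j)\<^sup>2) \<partial>G) \<partial>G) \<le> ennreal (4 * W)"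
    and T: "(\<Sum>J\<in>{J. J \<subseteq> I \<and> card J \<le> K}. 2 ^ card J) * (2 * L * \<tau>) \<le> T"
  shows "(\<integral>\<^sup>+g. (\<integral>\<^sup>+u. b2e (\<bar>discrepancy g u\<bar> \<le> \<tau>) \<partial>V) \<partial>G)
    \<le> ennreal (sqrt ((2 * R + W) / K + T) + T + sqrt (exp (- R) + 2 * (R + 1) / K))"
proof -
  have T_nonneg: "0 \<le> T"
    using L_nonneg tau_nonneg by (intro order_trans[OF _ T] mult_nonneg_nonneg sum_nonneg) auto
  let ?c = "sqrt (exp (- R) + 2 * (R + 1) / K)"
  let ?low = "\<lambda>g. \<integral>\<^sup>+u. b2e (flips g \<le> R \<and> \<bar>discrepancy g u\<bar> \<le> \<tau>) \<partial>V"
  interpret GV: pair_prob_space G V ..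
  have low_meas: "(\<lambda>(g, u). b2e (flips g \<le> R \<and> \<bar>discrepancy g u\<bar> \<le> \<tau>)) \<in> borel_measurable (G \<Otimes>\<^sub>M V)"
  proof -
    have [measurable]: "(\<lambda>p. flips (fst p)) \<in> borel_measurable (G \<Otimes>\<^sub>M V)"
        "(\<lambda>p. discrepancy (fst p) (snd p)) \<in> borel_measurable (G \<Otimes>\<^sub>M V)"
      by (intro flips_measurable discrepancy_measurable fst_snd_measurable)+
    show ?thesis unfolding split_beta' by measurable
  qed
  have "(\<integral>\<^sup>+u. b2e (\<bar>discrepancy g u\<bar> \<le> \<tau>) \<partial>V) \<le> ?low g + (b2e (\<not> separated K g) + ennreal ?c)"
    if g: "g \<in> space G" for g
  proof (cases "flips g \<le> R")
    case True
    then show ?thesis by simp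
  next
    case flips: False
    show ?thesis
    proof (cases "separated K g")
      case True
      then have "(\<integral>\<^sup>+u. b2e (\<bar>discrepancy g u\<bar> \<le> \<tau>) \<partial>V) \<le> ennreal ?c"
        using flips R by (intro ennreal_le_sqrt many_flips_bound K R g) auto
      then show ?thesis
        using True by (simp add: add_increasing)
    next
      case False
      have "(\<integral>\<^sup>+u. b2e (\<bar>discrepancy g u\<bar> \<le> \<tau>) \<partial>V) \<le> (\<integral>\<^sup>+u. 1 \<partial>V)"
        by (intro nn_integral_mono) auto
      also have "\<dots> = b2e (\<not> separated K g)"
        using False by (simp add: V.P.emeasure_space_1)
      finally show ?thesis
        by (rule order_trans) (simp add: add_increasing2 add_increasing)
    qed
  qed
  then have "(\<integral>\<^sup>+g. (\<integral>\<^sup>+u. b2e (\<bar>discrepancy g u\<bar> \<le> \<tau>) \<partial>V) \<partial>G)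
      \<le> (\<integral>\<^sup>+g. ?low g + (b2e (\<not> separated K g) + ennreal ?c) \<partial>G)"
    by (rule nn_integral_mono)
  also have "\<dots> = (\<integral>\<^sup>+g. ?low g \<partial>G) + ((\<integral>\<^sup>+g. b2e (\<not> separated K g) \<partial>G) + ennreal ?c)"
    using V.P.borel_measurable_nn_integral[OF low_meas] separated_measurable
    by (simp add: nn_integral_add G.P.emeasure_space_1)
  also have "(\<integral>\<^sup>+g. ?low g \<partial>G) = (\<integral>\<^sup>+u. (\<integral>\<^sup>+g. b2e (flips g \<le> R \<and> \<bar>discrepancy g u\<bar> \<le> \<tau>) \<partial>G) \<partial>V)"
    by (rule GV.Fubini'[OF low_meas, symmetric])
  also have "\<dots> \<le> ennreal (sqrt ((2 * R + W) / K + T))"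
  proof (rule ennreal_le_sqrt)
    \<comment> \<open>One \<open>T\<close> serves both union bounds, as the number of sets
      \<open>J\<close> is at most the same sum with weights \<open>2 ^ card J\<close>.\<close>
    have "real (card {J. J \<subseteq> I \<and> card J \<le> K}) = (\<Sum>J\<in>{J. J \<subseteq> I \<and> card J \<le> K}. 1)"
      by simp
    also have "\<dots> \<le> (\<Sum>J\<in>{J. J \<subseteq> I \<and> card J \<le> K}. 2 ^ card J)"
      by (intro sum_mono) simp
    finally have "card {J. J \<subseteq> I \<and> card J \<le> K} * (2 * L * \<tau>) \<le> T"
      using L_nonneg tau_nonneg by (intro order_trans[OF mult_right_mono T]) auto
    then show "(\<integral>\<^sup>+u. (\<integral>\<^sup>+g. b2e (flips g \<le> R \<and> \<bar>discrepancy g u\<bar> \<le> \<tau>) \<partial>G) \<partial>V)\<^sup>2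
        \<le> ennreal ((2 * R + W) / K + T)"
      by (intro order_trans[OF resampled_coordinate_bound[OF K R W i stable]] ennreal_leI) simp
    show "0 \<le> (2 * R + W) / K + T"
      using R W T_nonneg by simp
  qed
  also have "(\<integral>\<^sup>+g. b2e (\<not> separated K g) \<partial>G) \<le> ennreal T"
    using T by (intro order_trans[OF not_separated_le] ennreal_leI)
  also have "ennreal (sqrt ((2 * R + W) / K + T)) + (ennreal T + ennreal ?c)
      = ennreal (sqrt ((2 * R + W) / K + T) + T + ?c)"
    using T_nonneg R W by (simp add: add.assoc flip: ennreal_plus)
  finally show ?thesis
    by (simp add: add_mono)
qed

end

section \<open>The bound for fixed dimension\<close>

lemma bounded_density_interval:
  assumes "bounded_density L M X" "a \<le> b" "0 \<le> L"
  shows "emeasure (distr M borel X) {a..b} \<le> ennreal (L * (b - a))"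
proof -
  obtain p :: "real \<Rightarrow> real" where p: "\<And>x. 0 \<le> p x \<and> p x \<le> L"
    and d: "distributed M lborel X (\<lambda>x. ennreal (p x))"
    using assms(1) unfolding bounded_density_def by blast
  have [measurable]: "(\<lambda>x. ennreal (p x)) \<in> borel_measurable lborel"
    using d by (rule distributed_borel_measurable)
  have "distr M borel X = distr M lborel X"
    by (rule distr_cong) auto
  also have "\<dots> = density lborel (\<lambda>x. ennreal (p x))"
    using d by (rule distributed_distr_eq_density)
  finally have "emeasure (distr M borel X) {a..b} = emeasure (density lborel (\<lambda>x. ennreal (p x))) {a..b}"
    by simp
  also have "\<dots> = (\<integral>\<^sup>+x. ennreal (p x) * indicator {a..b} x \<partial>lborel)"
    by (rule emeasure_density) auto
  also have "\<dots> \<le> (\<integral>\<^sup>+x. ennreal L * indicator {a..b} x \<partial>lborel)"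
    using p by (intro nn_integral_mono mult_right_mono ennreal_leI) auto
  also have "\<dots> = ennreal (L * (b - a))"
    using assms(2,3) by (simp add: nn_integral_cmult ennreal_mult)
  finally show ?thesis .
qed

lemma exists_minimal:
  fixes f :: "'i \<Rightarrow> 'c :: linorder"
  assumes "finite S" "S \<noteq> {}"
  shows "\<exists>i\<in>S. \<forall>k\<in>S. f i \<le> f k"
proof -
  have "Min (f ` S) \<in> f ` S"
    using assms by (intro Min_in) auto
  then obtain i where "i \<in> S" "f i = Min (f ` S)"
    by fastforce
  then show ?thesis
    using assms(1) by (intro bexI[of _ i]) auto
qed

text \<open>Averaging: \<open>sum_influence_le\<close>, summed over the outputs \<open>j\<close>,
  bounds the sum over all \<open>i\<close> by \<open>4 * D * C * N\<close>, and the coordinate of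
  least influence has at most an \<open>N\<close>-th of it.\<close>

lemma exists_stable_coordinate:
  assumes prob: "\<And>i. prob_space (m i)" and borel: "\<And>i. sets (m i) = sets borel" and N: "0 < N"
    and A: "\<And>j. j \<in> {1..N} \<Longrightarrow> (\<lambda>x. A x j) \<in> coord_deg_le N (PiM {1..N} m) D"
    and energy: "(\<Sum>j\<in>{1..N}. \<integral>\<^sup>+g. ennreal ((A g j)\<^sup>2) \<partial>PiM {1..N} m) \<le> ennreal (C * real N)"
    and C: "0 \<le> C"
  shows "\<exists>i\<in>{1..N}. (\<Sum>j\<in>{1..N}. \<integral>\<^sup>+g. (\<integral>\<^sup>+g'. ennreal ((A g j - A (g(i := g' i)) j)\<^sup>2)
      \<partial>PiM {1..N} m) \<partial>PiM {1..N} m) \<le> ennreal (4 * (C * real D))"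
proof -
  let ?d = "\<lambda>i j. \<integral>\<^sup>+g. (\<integral>\<^sup>+g'. ennreal ((A g j - A (g(i := g' i)) j)\<^sup>2) \<partial>PiM {1..N} m) \<partial>PiM {1..N} m"
  have "\<exists>i\<in>{1..N}. \<forall>k\<in>{1..N}. (\<Sum>j\<in>{1..N}. ?d i j) \<le> (\<Sum>j\<in>{1..N}. ?d k j)"
    using N by (intro exists_minimal) auto
  then obtain i where i: "i \<in> {1..N}"
    and min: "\<forall>k\<in>{1..N}. (\<Sum>j\<in>{1..N}. ?d i j) \<le> (\<Sum>j\<in>{1..N}. ?d k j)"
    by (rule bexE)
  have "of_nat N * (\<Sum>j\<in>{1..N}. ?d i j) \<le> (\<Sum>k\<in>{1..N}. \<Sum>j\<in>{1..N}. ?d k j)"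
    using sum_bounded_below[of "{1..N}" "\<Sum>j\<in>{1..N}. ?d i j" "\<lambda>k. \<Sum>j\<in>{1..N}. ?d k j"] min by simp
  also have "(\<Sum>i\<in>{1..N}. \<Sum>j\<in>{1..N}. ?d i j) = (\<Sum>j\<in>{1..N}. \<Sum>i\<in>{1..N}. ?d i j)"
    by (rule sum.swap)
  also have "\<dots> \<le> (\<Sum>j\<in>{1..N}. ennreal (4 * real D) * (\<integral>\<^sup>+g. ennreal ((A g j)\<^sup>2) \<partial>PiM {1..N} m))"
    by (intro sum_mono sum_influence_le[where N = N] prob borel refl A)
  also have "\<dots> \<le> ennreal (4 * real D) * ennreal (C * real N)"
    unfolding sum_distrib_left[symmetric] by (intro mult_left_mono energy) simp
  also have "\<dots> = of_nat N * ennreal (4 * (C * real D))"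
    using C by (simp add: ennreal_of_nat_eq_real_of_nat ac_simps flip: ennreal_mult)
  finally have "(\<Sum>j\<in>{1..N}. ?d i j) \<le> ennreal (4 * (C * real D))"
    using N by (subst (asm) ennreal_mult_le_mult_iff) auto
  with i show ?thesis
    by blast
qed

lemma (in prob_space) distr_vec_of:
  assumes "indep_vars (\<lambda>_. borel) X {1..N}" "0 < N"
  shows "distr M (RN {1..N}) (vec_of N X) = PiM {1..N} (\<lambda>i. distr M borel (X i))"
proof -
  have rv: "random_variable borel (X i)" if "i \<in> {1..N}" for i
    using assms(1) that unfolding indep_vars_def by blast
  show ?thesis
    using assms rv unfolding vec_of_def
    by (subst indep_vars_iff_distr_eq_PiM'[symmetric]) auto
qed

text \<open>The independence assumptions turn the joint law into
  \<open>?G \<Otimes>\<^sub>M ?V\<close>, where \<open>solution_probability_le\<close> applies with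
  \<open>\<tau> = 2 powr (- E)\<close>; energy and degree enter through
  \<open>exists_stable_coordinate\<close>, which gives \<open>W = C * D\<close>.\<close>

lemma (in prob_space) rounding_solution_probability_le:
  fixes g U :: "nat \<Rightarrow> 'a \<Rightarrow> real" and A :: "(nat \<Rightarrow> real) \<Rightarrow> nat \<Rightarrow> real"
  assumes C: "0 \<le> C" and L: "0 \<le> L" and N: "0 < N"
    and g: "indep_vars (\<lambda>_. borel) g {1..N}" "\<And>i. i \<in> {1..N} \<Longrightarrow> bounded_density L M (g i)"
    and U: "indep_vars (\<lambda>_. borel) U {1..N}"
      "\<And>i. i \<in> {1..N} \<Longrightarrow> distr M lborel (U i) = uniform_measure lborel {-1..1}"
    and gU: "indep_var (RN {1..N}) (vec_of N g) (RN {1..N}) (vec_of N U)"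
    and A: "coord_deg_algorithm N (distr M (RN {1..N}) (vec_of N g)) D A"
    and energy: "(\<integral>\<omega>. (L2_set (A (vec_of N g \<omega>)) {1..N})\<^sup>2 \<partial>M) \<le> C * real N"
    and K: "0 < K" and R: "0 \<le> R"
    and T: "(\<Sum>J\<in>{J. J \<subseteq> {1..N} \<and> card J \<le> K}. 2 ^ card J) * (2 * L * 2 powr (- E)) \<le> T"
  shows "prob {\<omega> \<in> space M. rounding N A (vec_of N g \<omega>) (vec_of N U \<omega>) \<in> solution_set N E (vec_of N g \<omega>)}
    \<le> sqrt ((2 * R + C * real D) / K + T) + T + sqrt (exp (- R) + 2 * (R + 1) / K)"
proof -
  \<comment> \<open>The product construction asks for a probability measure at every index; outside
    \<open>{1..N}\<close> a point mass is the filler.\<close>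
  define m where "m i = (if i \<in> {1..N} then distr M borel (g i) else return borel 0)" for i
  have rv: "random_variable borel (g i)" if "i \<in> {1..N}" for i
    using g(1) that unfolding indep_vars_def by blast
  have prob_m: "prob_space (m i)" for i
    using rv by (auto simp: m_def intro: prob_space_distr prob_space_return)
  have sets_m: "sets (m i) = sets borel" for i
    by (simp add: m_def)
  let ?I = "{1..N}"
  let ?G = "PiM ?I m" and ?V = "PiM ?I (\<lambda>_. unif)"
  have law_g: "distr M (RN ?I) (vec_of N g) = ?G"
    unfolding distr_vec_of[OF g(1) N] by (rule PiM_cong) (auto simp: m_def)
  have law_U: "distr M (RN ?I) (vec_of N U) = ?V"
    unfolding distr_vec_of[OF U(1) N]
  proof (rule PiM_cong)
    fix i assume i: "i \<in> ?I"
    have "distr M borel (U i) = distr M lborel (U i)"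
      by (rule distr_cong) auto
    then show "distr M borel (U i) = unif"
      using U(2)[OF i] by simp
  qed simp
  have X: "vec_of N g \<in> M \<rightarrow>\<^sub>M RN ?I" "vec_of N U \<in> M \<rightarrow>\<^sub>M RN ?I"
    using gU by (auto simp: indep_var_distribution_eq)
  have joint: "distr M (RN ?I \<Otimes>\<^sub>M RN ?I) (\<lambda>\<omega>. (vec_of N g \<omega>, vec_of N U \<omega>)) = ?G \<Otimes>\<^sub>M ?V"
    using gU unfolding indep_var_distribution_eq law_g law_U by simp
  have A_meas: "A \<in> RN ?I \<rightarrow>\<^sub>M RN ?I"
    and A_deg: "\<And>j. j \<in> ?I \<Longrightarrow> (\<lambda>x. A x j) \<in> coord_deg_le N ?G D"
    using A unfolding coord_deg_algorithm_def law_g by auto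
  interpret rounded_algorithm ?I m L "2 powr (- E)" A
  proof (rule rounded_algorithm.intro)
    fix i and a b :: real assume "i \<in> ?I" "a \<le> b"
    then show "emeasure (m i) {a..b} \<le> ennreal (L * (b - a))"
      using bounded_density_interval[OF g(2) _ L] by (auto simp: m_def)
  qed (simp, rule prob_m, rule sets_m, rule A_meas, rule L, simp)
  \<comment> \<open>Membership in \<open>L2_space\<close> guarantees that the Bochner integral in
    \<open>energy\<close> is the true second moment and not the default value zero of a
    non-integrable function.\<close>
  have A_L2: "integrable ?G (\<lambda>g. (A g j)\<^sup>2)" if "j \<in> ?I" for j
    using coord_deg_le_L2[OF A_deg[OF that]] by (simp add: L2_space_def)
  have "(\<Sum>j\<in>?I. \<integral>\<^sup>+g. ennreal ((A g j)\<^sup>2) \<partial>?G) = (\<Sum>j\<in>?I. ennreal (\<integral>g. (A g j)\<^sup>2 \<partial>?G))"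
    using A_L2 by (intro sum.cong refl nn_integral_eq_integral) auto
  also have "\<dots> = ennreal (\<integral>g. (\<Sum>j\<in>?I. (A g j)\<^sup>2) \<partial>?G)"
    using A_L2 by (simp add: integral_sum)
  also have "(\<integral>g. (\<Sum>j\<in>?I. (A g j)\<^sup>2) \<partial>?G) = (\<integral>\<omega>. (L2_set (A (vec_of N g \<omega>)) ?I)\<^sup>2 \<partial>M)"
  proof -
    have "(\<lambda>g. \<Sum>j\<in>?I. (A g j)\<^sup>2) \<in> borel_measurable (RN ?I)"
      by (intro borel_measurable_sum borel_measurable_power A_measurable measurable_ident_sets refl)
    then have "(\<integral>g. (\<Sum>j\<in>?I. (A g j)\<^sup>2) \<partial>?G) = (\<integral>\<omega>. (\<Sum>j\<in>?I. (A (vec_of N g \<omega>) j)\<^sup>2) \<partial>M)"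
      unfolding law_g[symmetric] by (intro integral_distr X)
    then show ?thesis
      by (simp add: L2_set_def sum_nonneg)
  qed
  also have "ennreal \<dots> \<le> ennreal (C * real N)"
    by (intro ennreal_leI energy)
  finally have "\<exists>i\<in>?I. (\<Sum>j\<in>?I. \<integral>\<^sup>+g. (\<integral>\<^sup>+g'. ennreal ((A g j - A (g(i := g' i)) j)\<^sup>2)
      \<partial>?G) \<partial>?G) \<le> ennreal (4 * (C * real D))"
    by (intro exists_stable_coordinate[OF prob_m sets_m N A_deg _ C])
  then obtain i where i: "i \<in> ?I" and stable: "(\<Sum>j\<in>?I. \<integral>\<^sup>+g. (\<integral>\<^sup>+g'. ennreal ((A g j - A (g(i := g' i)) j)\<^sup>2)
      \<partial>?G) \<partial>?G) \<le> ennreal (4 * (C * real D))"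
    by (rule bexE)
  have T0: "0 \<le> T"
    using L by (intro order_trans[OF _ T] mult_nonneg_nonneg sum_nonneg) auto
  let ?S = "{\<omega> \<in> space M. rounding N A (vec_of N g \<omega>) (vec_of N U \<omega>) \<in> solution_set N E (vec_of N g \<omega>)}"
  \<comment> \<open>The rounding lies in \<open>sign_cube N\<close> by construction, so solving is a
    condition on the discrepancy alone.\<close>
  have S: "?S = {\<omega> \<in> space M. \<bar>discrepancy (vec_of N g \<omega>) (vec_of N U \<omega>)\<bar> \<le> 2 powr (- E)}"
  proof -
    have "rounding N A x u \<in> solution_set N E x \<longleftrightarrow> \<bar>discrepancy x u\<bar> \<le> 2 powr (- E)" for x u
    proof -
      have "rounding N A x u \<in> sign_cube N"
        by (auto simp: rounding_def sign_cube_def sign_pm_def)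
      moreover have "(\<Sum>i=1..N. x i * rounding N A x u i) = discrepancy x u"
        unfolding discrepancy_def rounded_def rounding_def by (intro sum.cong) auto
      ultimately show ?thesis
        by (simp add: solution_set_def)
    qed
    then show ?thesis by simp
  qed
  have disc: "(\<lambda>p. discrepancy (fst p) (snd p)) \<in> borel_measurable (RN ?I \<Otimes>\<^sub>M RN ?I)"
    by (intro discrepancy_measurable measurable_fst measurable_snd)
  have d_meas: "(\<lambda>p. b2e (\<bar>discrepancy (fst p) (snd p)\<bar> \<le> 2 powr (- E))) \<in> borel_measurable (RN ?I \<Otimes>\<^sub>M RN ?I)"
    using disc by measurable
  have d_meas': "(\<lambda>p. b2e (\<bar>discrepancy (fst p) (snd p)\<bar> \<le> 2 powr (- E)))
      \<in> borel_measurable (distr M (RN ?I \<Otimes>\<^sub>M RN ?I) (\<lambda>\<omega>. (vec_of N g \<omega>, vec_of N U \<omega>)))"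
    unfolding measurable_distr_eq1 by (rule d_meas)
  have S_sets: "?S \<in> sets M"
  proof -
    have [measurable]: "(\<lambda>\<omega>. discrepancy (vec_of N g \<omega>) (vec_of N U \<omega>)) \<in> borel_measurable M"
      by (intro discrepancy_measurable X)
    show ?thesis unfolding S by measurable
  qed
  have "ennreal (prob ?S) = (\<integral>\<^sup>+\<omega>. indicator ?S \<omega> \<partial>M)"
    using S_sets by (simp add: emeasure_eq_measure)
  also have "\<dots> = (\<integral>\<^sup>+\<omega>. b2e (\<bar>discrepancy (vec_of N g \<omega>) (vec_of N U \<omega>)\<bar> \<le> 2 powr (- E)) \<partial>M)"
    unfolding S by (intro nn_integral_cong) (auto simp: indicator_def)
  also have "\<dots> = (\<integral>\<^sup>+p. b2e (\<bar>discrepancy (fst p) (snd p)\<bar> \<le> 2 powr (- E)) \<partial>(?G \<Otimes>\<^sub>M ?V))"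
    unfolding joint[symmetric] nn_integral_distr[OF measurable_Pair[OF X] d_meas'] fst_conv snd_conv ..
  also have "\<dots> = (\<integral>\<^sup>+g. (\<integral>\<^sup>+u. b2e (\<bar>discrepancy g u\<bar> \<le> 2 powr (- E)) \<partial>?V) \<partial>?G)"
  proof -
    have "(\<lambda>p. b2e (\<bar>discrepancy (fst p) (snd p)\<bar> \<le> 2 powr (- E))) \<in> borel_measurable (?G \<Otimes>\<^sub>M ?V)"
      using d_meas' unfolding joint .
    from V.P.nn_integral_fst[OF this] show ?thesis
      unfolding fst_conv snd_conv ..
  qed
  also have "\<dots> \<le> ennreal (sqrt ((2 * R + C * real D) / K + T) + T + sqrt (exp (- R) + 2 * (R + 1) / K))"
    using C by (intro solution_probability_le[OF K R _ i stable T]) simp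
  finally show ?thesis
    using T0 C R by (subst (asm) ennreal_le_iff) auto
qed

section \<open>Choosing the radius\<close>

text \<open>The order of limits is \<open>n\<close> to infinity at fixed \<open>R\<close>, then
  \<open>R\<close> to infinity: given \<open>a\<close>, first \<open>R\<close> is chosen with
  \<open>sqrt (exp (- R)) < a\<close>, then \<open>n\<close> large.\<close>

lemma tendsto_zero_if_le_exp:
  fixes p :: "nat \<Rightarrow> real" and b :: "real \<Rightarrow> nat \<Rightarrow> real"
  assumes nonneg: "\<And>n. 0 \<le> p n"
    and le: "\<And>R. 0 \<le> R \<Longrightarrow> \<forall>\<^sub>F n in sequentially. p n \<le> b R n"
    and lim: "\<And>R. 0 \<le> R \<Longrightarrow> b R \<longlonglongrightarrow> sqrt (exp (- R))"
  shows "p \<longlonglongrightarrow> 0"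
proof (rule order_tendstoI)
  fix a :: real assume "a < 0"
  then show "\<forall>\<^sub>F n in sequentially. a < p n"
    using nonneg by (intro always_eventually allI) (rule order.strict_trans2)
next
  fix a :: real assume a: "0 < a"
  have "((\<lambda>R::real. sqrt (exp (- R))) \<longlongrightarrow> 0) at_top"
    by real_asymp
  then have "\<forall>\<^sub>F R in at_top. sqrt (exp (- R)) < a"
    using a by (rule order_tendstoD)
  with eventually_ge_at_top[of "0::real"] have "\<forall>\<^sub>F R in at_top. 0 \<le> R \<and> sqrt (exp (- R)) < a"
    by eventually_elim simp
  then obtain R :: real where R: "0 \<le> R" "sqrt (exp (- R)) < a"
    by (auto simp: eventually_at_top_linorder)
  from le[OF R(1)] order_tendstoD(2)[OF lim[OF R(1)] R(2)]
  show "\<forall>\<^sub>F n in sequentially. p n < a"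
    by eventually_elim simp
qed

text \<open>Here \<open>l N * N\<close> is the Hamming radius within which solutions are excluded.\<close>

lemma radius_suffices:
  fixes l E :: "nat \<Rightarrow> real" and D :: "nat \<Rightarrow> nat" and C L :: real and p :: "nat \<Rightarrow> real"
  assumes L: "0 \<le> L" and l: "\<forall>\<^sub>F N in sequentially. 0 < l N \<and> l N \<le> 1"
    and radius: "filterlim (\<lambda>N. l N * N) at_top sequentially"
    and degree: "(\<lambda>N. D N / (l N * N)) \<longlonglongrightarrow> 0"
    and entropy: "filterlim (\<lambda>N. E N * ln 2 - l N * N * (2 + ln (1 / l N))) at_top sequentially"
    and p_nonneg: "\<And>N. 0 \<le> p N"
    and p: "\<And>N K R T. 0 < N \<Longrightarrow> 0 < K \<Longrightarrow> 0 \<le> R \<Longrightarrow>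
      (\<Sum>J\<in>{J. J \<subseteq> {1..N} \<and> card J \<le> K}. 2 ^ card J) * (2 * L * 2 powr (- E N)) \<le> T \<Longrightarrow>
      p N \<le> sqrt ((2 * R + C * real (D N)) / real K + T) + T + sqrt (exp (- R) + 2 * (R + 1) / real K)"
  shows "p \<longlonglongrightarrow> 0"
proof -
  \<comment> \<open>\<open>K N\<close> is the integer radius. \<open>T N\<close> is
    \<open>2 * L * 2 powr (- E N)\<close> times the bound of \<open>sum_two_power_card_le\<close>,
    and \<open>entropy\<close> sends it to zero.\<close>
  define K where "K N = nat \<lfloor>l N * N\<rfloor>" for N
  define T where "T N = 2 * L * exp (- (E N * ln 2 - l N * N * (2 + ln (1 / l N))))" for N
  have K_le: "\<forall>\<^sub>F N in sequentially. real (K N) \<le> l N * N"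
    using l by eventually_elim (simp add: K_def)
  \<comment> \<open>Once the radius exceeds 2, rounding down loses at most half of it.\<close>
  have K_ge: "\<forall>\<^sub>F N in sequentially. l N * N / 2 \<le> K N"
    using filterlim_at_top_dense[THEN iffD1, OF radius, rule_format, of 2]
  proof eventually_elim
    case (elim N)
    have "l N * N - 1 \<le> \<lfloor>l N * N\<rfloor>" by linarith
    also have "\<dots> \<le> K N" using elim by (simp add: K_def)
    finally show ?case using elim by simp
  qed
  have K_top: "filterlim (\<lambda>N. real (K N)) at_top sequentially"
  proof (rule filterlim_at_top_mono[OF _ K_ge])
    show "filterlim (\<lambda>N. l N * N / 2) at_top sequentially"
      using filterlim_tendsto_pos_mult_at_top[OF tendsto_const _ radius, of "1 / 2"] by simp
  qed
  have T_lim: "T \<longlonglongrightarrow> 0"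
  proof -
    have "filterlim (\<lambda>N. - (E N * ln 2 - l N * N * (2 + ln (1 / l N)))) at_bot sequentially"
      using entropy unfolding filterlim_uminus_at_top .
    then have "(\<lambda>N. exp (- (E N * ln 2 - l N * N * (2 + ln (1 / l N))))) \<longlonglongrightarrow> 0"
      by (rule filterlim_compose[OF exp_at_bot])
    from tendsto_mult_left[OF this, of "2 * L"] show ?thesis
      by (simp add: T_def[abs_def])
  qed
  have D_lim: "(\<lambda>N. D N / K N) \<longlonglongrightarrow> 0"
  proof (rule tendsto_sandwich[OF _ _ tendsto_const])
    show "(\<lambda>N. 2 * (D N / (l N * N))) \<longlonglongrightarrow> 0"
      using tendsto_mult_left[OF degree, of 2] by simp
    show "\<forall>\<^sub>F N in sequentially. D N / K N \<le> 2 * (D N / (l N * N))"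
      using K_ge filterlim_at_top_dense[THEN iffD1, OF radius, rule_format, of 0]
    proof eventually_elim
      case (elim N)
      have "D N / K N \<le> D N / (l N * N / 2)"
        using elim by (intro divide_left_mono) auto
      then show ?case by (simp add: mult.commute)
    qed
  qed auto
  show ?thesis
  proof (rule tendsto_zero_if_le_exp[OF p_nonneg])
    fix R :: real assume R: "0 \<le> R"
    show "\<forall>\<^sub>F N in sequentially. p N \<le> sqrt ((2 * R + C * real (D N)) / real (K N) + T N) + T N
        + sqrt (exp (- R) + 2 * (R + 1) / real (K N))"
      using K_le l eventually_gt_at_top[of 0] filterlim_at_top_dense[THEN iffD1, OF K_top, rule_format, of 0]
    proof eventually_elim
      case (elim N)
      have "(\<Sum>J\<in>{J. J \<subseteq> {1..N} \<and> card J \<le> K N}. 2 ^ card J)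
          \<le> exp (l N * card {1..N} * (2 + ln (1 / l N)))"
        using elim by (intro sum_two_power_card_le) auto
      then have "(\<Sum>J\<in>{J. J \<subseteq> {1..N} \<and> card J \<le> K N}. 2 ^ card J) * (2 * L * 2 powr (- E N))
          \<le> exp (l N * card {1..N} * (2 + ln (1 / l N))) * (2 * L * 2 powr (- E N))"
        using L by (intro mult_right_mono) auto
      also have "\<dots> = T N"
        by (simp add: T_def powr_def exp_diff exp_minus field_simps)
      finally show ?case
        using elim R by (intro p) auto
    qed
    have inv: "(\<lambda>N. 1 / real (K N)) \<longlonglongrightarrow> 0"
      using tendsto_divide_0[OF tendsto_const filterlim_at_top_imp_at_infinity[OF K_top]] .
    have 1: "(\<lambda>N. (2 * R + C * real (D N)) / real (K N)) \<longlonglongrightarrow> 0"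
      using tendsto_add[OF tendsto_mult_left[OF inv, of "2 * R"] tendsto_mult_left[OF D_lim, of C]]
      by (simp add: add_divide_distrib)
    have 2: "(\<lambda>N. 2 * (R + 1) / real (K N)) \<longlonglongrightarrow> 0"
      using tendsto_mult_left[OF inv, of "2 * (R + 1)"] by simp
    have "(\<lambda>N. sqrt ((2 * R + C * real (D N)) / real (K N) + T N) + T N
        + sqrt (exp (- R) + 2 * (R + 1) / real (K N))) \<longlonglongrightarrow> sqrt (0 + 0) + 0 + sqrt (exp (- R) + 0)"
      by (intro tendsto_intros 1 2 T_lim)
    then show "(\<lambda>N. sqrt ((2 * R + C * real (D N)) / real (K N) + T N) + T N
        + sqrt (exp (- R) + 2 * (R + 1) / real (K N))) \<longlonglongrightarrow> sqrt (exp (- R))"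
      by simp
  qed
qed

text \<open>A constant proportion \<open>c\<close> works: the entropy cost
  \<open>c * (2 + ln (1 / c))\<close> vanishes as \<open>c\<close> tends to 0, so it can be kept
  below half of the available \<open>\<delta> * ln 2\<close>.\<close>

lemma radius_linear_energy:
  fixes E :: "nat \<Rightarrow> real" and D :: "nat \<Rightarrow> nat" and \<delta> :: real
  assumes \<delta>: "0 < \<delta>" and E: "\<And>N. E N = \<delta> * real N" and D: "(\<lambda>N. real (D N)) \<in> o(\<lambda>N. real N)"
  obtains l :: "nat \<Rightarrow> real" where
    "\<forall>\<^sub>F N in sequentially. 0 < l N \<and> l N \<le> 1"
    "filterlim (\<lambda>N. l N * N) at_top sequentially"
    "(\<lambda>N. D N / (l N * N)) \<longlonglongrightarrow> 0"
    "filterlim (\<lambda>N. E N * ln 2 - l N * N * (2 + ln (1 / l N))) at_top sequentially"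
proof -
  have "((\<lambda>x::real. x * (2 + ln (1 / x))) \<longlongrightarrow> 0) (at_right 0)"
    by real_asymp
  moreover have "0 < \<delta> * ln 2 / 2"
    using \<delta> by simp
  ultimately have "\<forall>\<^sub>F x in at_right 0. x * (2 + ln (1 / x)) < \<delta> * ln 2 / 2"
    by (rule order_tendstoD)
  moreover have "\<forall>\<^sub>F x::real in at_right 0. 0 < x \<and> x \<le> 1"
    using eventually_at_right_real[OF zero_less_one] by eventually_elim auto
  ultimately have "\<forall>\<^sub>F x in at_right 0. x * (2 + ln (1 / x)) < \<delta> * ln 2 / 2 \<and> 0 < x \<and> x \<le> 1"
    by (rule eventually_conj)
  then obtain c :: real where c: "c * (2 + ln (1 / c)) < \<delta> * ln 2 / 2" "0 < c" "c \<le> 1"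
    using eventually_happens'[of "at_right (0::real)"] by auto
  show thesis
  proof (rule that[of "\<lambda>_. c"])
    show "filterlim (\<lambda>N. c * real N) at_top sequentially"
      using c(2) by real_asymp
    have "(\<lambda>N. D N / real N) \<longlonglongrightarrow> 0"
      using D by (rule smalloD_tendsto)
    from tendsto_mult_left[OF this, of "1 / c"] show "(\<lambda>N. D N / (c * real N)) \<longlonglongrightarrow> 0"
      by simp
    show "filterlim (\<lambda>N. E N * ln 2 - c * N * (2 + ln (1 / c))) at_top sequentially"
    proof (rule filterlim_at_top_mono)
      have "0 < \<delta> * ln 2 / 2"
        using \<delta> by simp
      then show "filterlim (\<lambda>N. \<delta> * ln 2 / 2 * real N) at_top sequentially"
        by real_asymp
      have "\<delta> * ln 2 / 2 * real N \<le> E N * ln 2 - c * N * (2 + ln (1 / c))" for N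
        using mult_right_mono[OF less_imp_le[OF c(1)], of "real N"] by (simp add: E algebra_simps)
      then show "\<forall>\<^sub>F N in sequentially. \<delta> * ln 2 / 2 * real N \<le> E N * ln 2 - c * N * (2 + ln (1 / c))"
        by simp
    qed
  qed (use c in auto)
qed

text \<open>With \<open>x = E N / N\<close> tending to 0, the radius is
  \<open>E N / (4 * ln (1 / x))\<close>. Its entropy cost is about \<open>E N / 4\<close>, less than
  \<open>E N * ln 2\<close>. It tends to infinity because \<open>E N\<close> outgrows
  \<open>(ln N)\<^sup>2\<close> while \<open>ln (1 / x) \<le> ln N\<close>. It dominates the degree
  because \<open>ln (1 / x) > 1\<close> lets the squared logarithm in the hypothesis absorb the
  single one.\<close>

lemma radius_sublinear_energy:
  fixes E :: "nat \<Rightarrow> real" and D :: "nat \<Rightarrow> nat"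
  assumes pos: "\<forall>\<^sub>F N in sequentially. E N > 0" and lower: "E \<in> \<omega>(\<lambda>N. (ln (real N))\<^sup>2)"
    and upper: "E \<in> o(\<lambda>N. real N)" and D: "(\<lambda>N. real (D N)) \<in> o(\<lambda>N. E N / (ln (real N / E N))\<^sup>2)"
  obtains l :: "nat \<Rightarrow> real" where
    "\<forall>\<^sub>F N in sequentially. 0 < l N \<and> l N \<le> 1"
    "filterlim (\<lambda>N. l N * N) at_top sequentially"
    "(\<lambda>N. D N / (l N * N)) \<longlonglongrightarrow> 0"
    "filterlim (\<lambda>N. E N * ln 2 - l N * N * (2 + ln (1 / l N))) at_top sequentially"
proof -
  define x where "x N = E N / real N" for N
  define l where "l N = x N / (4 * ln (1 / x N))" for N
  have N_pos: "\<forall>\<^sub>F N in sequentially. 0 < real N"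
    by real_asymp
  have x_pos: "\<forall>\<^sub>F N in sequentially. 0 < x N"
    using pos N_pos by eventually_elim (simp add: x_def)
  have x_lim: "filterlim x (at_right 0) sequentially"
    unfolding x_def[abs_def] using smalloD_tendsto[OF upper] x_pos
    by (intro tendsto_imp_filterlim_at_right) (auto simp: x_def)
  have ev: "\<forall>\<^sub>F N in sequentially. P (x N)" if "\<forall>\<^sub>F y in at_right 0. P y" for P
    using filterlim_iff[THEN iffD1, OF x_lim] that by blast
  have "\<forall>\<^sub>F y::real in at_right 0. 0 < y / (4 * ln (1 / y)) \<and> y / (4 * ln (1 / y)) \<le> 1"
    by (intro eventually_conj; real_asymp)
  note l = ev[OF this, folded l_def]
  have "\<forall>\<^sub>F y::real in at_right 0. 1 < ln (1 / y)"
    by real_asymp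
  note ln_x = ev[OF this]
  have radius_eq: "\<forall>\<^sub>F N in sequentially. l N * N = E N / (4 * ln (1 / x N))"
    using N_pos by eventually_elim (simp add: l_def x_def)
  have lnN_top: "filterlim (\<lambda>N. ln (real N) / 4) at_top sequentially"
    by real_asymp
  have E_ge: "\<forall>\<^sub>F N in sequentially. (ln (real N))\<^sup>2 \<le> E N"
    using landau_omega.smallD[OF lower zero_less_one] pos by eventually_elim simp
  have "\<forall>\<^sub>F N in sequentially. 1 \<le> (ln (real N))\<^sup>2"
    by real_asymp
  with E_ge have E_ge_1: "\<forall>\<^sub>F N in sequentially. 1 \<le> E N"
    by eventually_elim simp
  have E_top: "filterlim E at_top sequentially"
    by (rule filterlim_at_top_mono[OF _ E_ge]) real_asymp
  have radius_ge: "\<forall>\<^sub>F N in sequentially. ln (real N) / 4 \<le> l N * N"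
    using radius_eq E_ge E_ge_1 ln_x N_pos
  proof eventually_elim
    case (elim N)
    \<comment> \<open>\<open>E N \<ge> 1\<close> gives \<open>1 / x N \<le> N\<close>.\<close>
    have "ln (1 / x N) \<le> ln (real N)"
      using elim by (subst ln_le_cancel_iff) (auto simp: x_def field_simps)
    moreover have "ln (real N) * ln (1 / x N) \<le> ln (real N) * ln (real N)"
      using elim calculation by (intro mult_left_mono) auto
    ultimately have "ln (real N) * ln (1 / x N) \<le> E N"
      using elim by (simp add: power2_eq_square)
    then have "ln (real N) \<le> E N / ln (1 / x N)"
      using elim by (simp add: pos_le_divide_eq)
    then show ?case
      unfolding elim(1) by simp
  qed
  show thesis
  proof (rule that[of l])
    show "filterlim (\<lambda>N. l N * N) at_top sequentially"
      by (rule filterlim_at_top_mono[OF lnN_top radius_ge])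
    show "(\<lambda>N. D N / (l N * N)) \<longlonglongrightarrow> 0"
    proof (rule tendsto_sandwich[OF _ _ tendsto_const])
      have "(\<lambda>N. D N / (E N / (ln (real N / E N))\<^sup>2)) \<longlonglongrightarrow> 0"
        using D by (rule smalloD_tendsto)
      from tendsto_mult_left[OF this, of 4]
      show "(\<lambda>N. 4 * (D N / (E N / (ln (real N / E N))\<^sup>2))) \<longlonglongrightarrow> 0"
        by simp
      show "\<forall>\<^sub>F N in sequentially. D N / (l N * N) \<le> 4 * (D N / (E N / (ln (real N / E N))\<^sup>2))"
        using radius_eq ln_x E_ge_1
      proof eventually_elim
        case (elim N)
        have "ln (1 / x N) \<le> (ln (1 / x N))\<^sup>2"
          using elim by (intro self_le_power) auto
        then have "D N * 4 * ln (1 / x N) / E N \<le> D N * 4 * (ln (1 / x N))\<^sup>2 / E N"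
          using elim by (intro divide_right_mono mult_left_mono) auto
        moreover have "D N / (l N * N) = D N * 4 * ln (1 / x N) / E N"
          unfolding elim(1) by simp
        moreover have "4 * (D N / (E N / (ln (real N / E N))\<^sup>2)) = D N * 4 * (ln (1 / x N))\<^sup>2 / E N"
          by (simp add: x_def)
        ultimately show ?case
          by (simp only:)
      qed
      show "\<forall>\<^sub>F N in sequentially. 0 \<le> D N / (l N * N)"
        using l by eventually_elim simp
    qed
    show "filterlim (\<lambda>N. E N * ln 2 - l N * N * (2 + ln (1 / l N))) at_top sequentially"
    proof (rule filterlim_at_top_mono)
      show "filterlim (\<lambda>N. 1 / 6 * E N) at_top sequentially"
        by (rule filterlim_tendsto_pos_mult_at_top[OF tendsto_const _ E_top]) simp
      \<comment> \<open>The 4 in \<open>l\<close> makes this limit 1/4, below \<open>ln 2\<close>.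
        The cruder bound 1/2 against \<open>ln 2 \<ge> 2 / 3\<close> leaves the slack
        \<open>1 / 6\<close> used above.\<close>
      have "((\<lambda>y::real. (2 + ln (1 / (y / (4 * ln (1 / y))))) / (4 * ln (1 / y))) \<longlongrightarrow> 1 / 4) (at_right 0)"
        by real_asymp
      then have "\<forall>\<^sub>F y::real in at_right 0. (2 + ln (1 / (y / (4 * ln (1 / y))))) / (4 * ln (1 / y)) < 1 / 2"
        by (rule order_tendstoD) simp
      note b = ev[OF this, folded l_def]
      show "\<forall>\<^sub>F N in sequentially. 1 / 6 * E N \<le> E N * ln 2 - l N * N * (2 + ln (1 / l N))"
        using b radius_eq E_ge_1
      proof eventually_elim
        case (elim N)
        have "l N * N * (2 + ln (1 / l N)) = E N * ((2 + ln (1 / l N)) / (4 * ln (1 / x N)))"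
          using elim by simp
        also have "\<dots> \<le> E N * (1 / 2)"
          using elim by (intro mult_left_mono) auto
        finally have "l N * N * (2 + ln (1 / l N)) \<le> E N * (1 / 2)" .
        moreover have "E N * (2 / 3) \<le> E N * ln 2"
          using elim by (intro mult_left_mono ln2_ge_two_thirds) auto
        ultimately show ?case
          by linarith
      qed
    qed
  qed (rule l)
qed

theorem mainTheorem3:
  fixes C L :: real
    and M :: "nat \<Rightarrow> 'a measure"
    and g U :: "nat \<Rightarrow> nat \<Rightarrow> 'a \<Rightarrow> real"
    and A :: "nat \<Rightarrow> (nat \<Rightarrow> real) \<Rightarrow> nat \<Rightarrow> real"
    and D :: "nat \<Rightarrow> nat"
    and E :: "nat \<Rightarrow> real"
  assumes "C > 0" and "L > 0"
    and "\<And>N. prob_space (M N)"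
    and "\<And>N. prob_space.indep_vars (M N) (\<lambda>_. borel) (g N) {1..N}"
    and "\<And>N i. i \<in> {1..N} \<Longrightarrow> bounded_density L (M N) (g N i)"
    and "\<And>N. prob_space.indep_vars (M N) (\<lambda>_. borel) (U N) {1..N}"
    and "\<And>N i. i \<in> {1..N} \<Longrightarrow> distr (M N) lborel (U N i) = uniform_measure lborel {-1..1}"
    and "\<And>N. prob_space.indep_var (M N) (RN {1..N}) (vec_of N (g N)) (RN {1..N}) (vec_of N (U N))"
    and "\<And>N. coord_deg_algorithm N (distr (M N) (RN {1..N}) (vec_of N (g N))) (D N) (A N)"
    and "\<And>N. (\<integral>\<omega>. (L2_set (A N (vec_of N (g N) \<omega>)) {1..N})\<^sup>2 \<partial>M N) \<le> C * real N"
    and "(\<exists>\<delta>\<in>{0<..<1}. (\<forall>N. E N = \<delta> * real N) \<and> (\<lambda>N. real (D N)) \<in> o(\<lambda>N. real N)) \<or>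
         ((\<forall>\<^sub>F N in sequentially. E N > 0) \<and> E \<in> \<omega>(\<lambda>N. (ln (real N))\<^sup>2) \<and> E \<in> o(\<lambda>N. real N) \<and>
          (\<lambda>N. real (D N)) \<in> o(\<lambda>N. E N / (ln (real N / E N))\<^sup>2))"
  shows "(\<lambda>N. measure (M N)
            {\<omega> \<in> space (M N). rounding N (A N) (vec_of N (g N) \<omega>) (vec_of N (U N) \<omega>)
                \<in> solution_set N (E N) (vec_of N (g N) \<omega>)}) \<longlonglongrightarrow> 0"
proof -
  \<comment> \<open>The two energy regimes differ in the choice of the relative radius
    \<open>l\<close>; after that \<open>radius_suffices\<close> treats them alike.\<close>
  obtain l :: "nat \<Rightarrow> real" where l:
    "\<forall>\<^sub>F N in sequentially. 0 < l N \<and> l N \<le> 1"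
    "filterlim (\<lambda>N. l N * N) at_top sequentially"
    "(\<lambda>N. D N / (l N * N)) \<longlonglongrightarrow> 0"
    "filterlim (\<lambda>N. E N * ln 2 - l N * N * (2 + ln (1 / l N))) at_top sequentially"
    using assms(11)
  proof (elim disjE bexE conjE)
    fix \<delta> assume *: "\<delta> \<in> {0<..<1::real}" "\<forall>N. E N = \<delta> * real N" "(\<lambda>N. real (D N)) \<in> o(\<lambda>N. real N)"
    then have "0 < \<delta>" "\<And>N. E N = \<delta> * real N"
      by auto
    from radius_linear_energy[OF this *(3)] show thesis
      using that .
  next
    assume "\<forall>\<^sub>F N in sequentially. E N > 0" "E \<in> \<omega>(\<lambda>N. (ln (real N))\<^sup>2)" "E \<in> o(\<lambda>N. real N)"
      "(\<lambda>N. real (D N)) \<in> o(\<lambda>N. E N / (ln (real N / E N))\<^sup>2)"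
    from radius_sublinear_energy[OF this] show thesis
      using that .
  qed
  show ?thesis
  proof (rule radius_suffices[OF _ l, where L = L and C = C])
    show "0 \<le> L"
      using assms(2) by simp
    show "0 \<le> measure (M N) {\<omega> \<in> space (M N). rounding N (A N) (vec_of N (g N) \<omega>) (vec_of N (U N) \<omega>)
                \<in> solution_set N (E N) (vec_of N (g N) \<omega>)}" for N
      by simp
    fix N K :: nat and R T :: real
    assume *: "0 < N" "0 < K" "0 \<le> R"
      "(\<Sum>J\<in>{J. J \<subseteq> {1..N} \<and> card J \<le> K}. 2 ^ card J) * (2 * L * 2 powr (- E N)) \<le> T"
    interpret prob_space "M N" by fact
    show "measure (M N) {\<omega> \<in> space (M N). rounding N (A N) (vec_of N (g N) \<omega>) (vec_of N (U N) \<omega>)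
                \<in> solution_set N (E N) (vec_of N (g N) \<omega>)}
        \<le> sqrt ((2 * R + C * real (D N)) / real K + T) + T + sqrt (exp (- R) + 2 * (R + 1) / real K)"
      using assms(1,2)
      by (intro rounding_solution_probability_le[OF _ _ *(1) assms(4-10) *(2-4)]) simp_all
  qed
qed

end
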